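(* Assume that $\mathbb{P}[D_1=0]=\alpha_0>0$ and $\mathbb{P}[D_1=1]=\alpha_1>0$, and that $p<1$. Let $\delta\in(0,1]$. Under the $(s,q)$-policy, the Markov chain generated by the system dynamics, $\{X_i^{(s,q)}=(I_i^{(s,q)},B_{i-1}^{(s,q)},Q_{i-\tau}^{(s,q)},\dots,Q_{i-1}^{(s,q)}):i\ge1\}$, is geometrically ergodic with steady state $X_\infty^{(s,q)}$. In particular, for all ${\bf x}\in\mathcal{X}^{(s,q)}$ (and all $i\ge1$), $$\sum_{{\bf y}\in\mathcal{X}^{(s,q)}}\Big|\mathbb{P}\big[X_i^{(s,q)}={\bf y}\,\big|\,X_1^{(s,q)}={\bf x}\big]-\mathbb{P}\big[X_\infty^{(s,q)}={\bf y}\big]\Big|\ \le\ \mathcal{V}({\bf x})\,\frac{(1+\beta(s,q))\,\rho^{i+1}(s,q)}{\rho(s,q)-\theta(s,q)},$$ where $\mathcal{V}({\bf x})=p\cdot(x_2)^\delta+1$ for ${\bf x}=(x_1,x_2,\dots,x_{2+\tau})\in\mathcal{X}^{(s,q)}$, and $\beta(s,q)$, $\theta(s,q)$, $\rho(s,q)$ are three positive constants that depend only on $\alpha_0,\alpha_1$, $p$ and $(s,q)$, with $\theta(s,q)\in(0,1)$ and $\rho(s,q)\in(\theta(s,q),1)$.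
   Context: Notation: $x^+=\max\{x,0\}$, $a_{[i,k]}=\sum_{j=i}^k a_j$ (equal to $0$ if $i>k$). Partial backorder system. Fixed nonnegative integer lead time $\tau$, patience parameter $p$. Demands $D_1,D_2,\dots$ are i.i.d. nonnegative integer-valued with finite mean $d$. For each period $i$, $\{\xi_{i;\ell}:\ell\ge1\}$ are i.i.d. Bernoulli random variables with mean $p$; these families are independent over $i$ and independent of the demands. The state at the beginning of period $i$ is $X_i=(I_i,B_{i-1},Q_{i-\tau},\dots,Q_{i-1})$ (on-hand inventory, backorders, outstanding orders), nonnegative integers with $I_iB_{i-1}=0$. In period $i$: the order $Q_{i-\tau}$ arrives; an order $Q_i$ is placed (delivered at the start of period $i+\tau$); demand $D_i$ is realized; the unmet demand is $U_i=(B_{i-1}+D_i-I_i-Q_{i-\tau})^+$ and $I_{i+1}=(I_i+Q_{i-\tau}-B_{i-1}-D_i)^+$; $B_i=\xi_{i;[1,U_i]}$ is backordered and $U_i-B_i$ is lost. For nonnegative integers $s,q$, the $(s,q)$-policy orders $Q_i^{(s,q)}=(s+q\cdot\mathbb{I}_{\{I_i^{(s,q)}=0\}}-I_i^{(s,q)}-Q^{(s,q)}_{[i-\tau,i-1]})^+$. Under it the states form a Markov chain with state space $$\mathcal{X}^{(s,q)}=\{(x_1,\dots,x_{\tau+2}):x_1+x_{[3,\tau+2]}\le s+q,\ x_1x_2=0,\ x_j\in\{0,1,2,\dots\}\}.$$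
   Formalization: The constants β, θ, ρ may also depend on the lead time τ, the mean demand d and δ; with dependence only on α0, α1, p and (s,q) the claim is false (large backlogs with δ→0, rare huge demands, or τ→∞ rule out a uniform rate). *)

theory Defs
  imports "HOL-Probability.Probability"
begin

(* Primitive randomness of the partial backorder system.  Periods and customers are numbered
   from 1; D 0, \<xi> 0 l and \<xi> i 0 are never used.  The Bernoulli variables \<xi> i l take
   values in {0, 1}, so that demands and patience variables can be put into one jointly
   independent family. *)
locale partial_backorder_system = prob_space M for M :: "'w measure" +
  fixes p d :: real
    and D :: "nat \<Rightarrow> 'w \<Rightarrow> nat"
    and \<xi> :: "nat \<Rightarrow> nat \<Rightarrow> 'w \<Rightarrow> nat"
  assumes p_nonneg: "0 \<le> p" and p_le_1: "p \<le> 1"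
    and indep_primitives:
      "indep_vars (\<lambda>_. count_space UNIV) (case_sum D (\<lambda>(i, l). \<xi> i l)) ({1..} <+> {1..} \<times> {1..})"
    and demand_identically_distributed:
      "i \<ge> 1 \<Longrightarrow> distr M (count_space UNIV) (D i) = distr M (count_space UNIV) (D 1)"
    and demand_integrable: "integrable M (\<lambda>\<omega>. real (D 1 \<omega>))"
    and demand_mean: "expectation (\<lambda>\<omega>. real (D 1 \<omega>)) = d"
    and patience_bernoulli:
      "i \<ge> 1 \<Longrightarrow> l \<ge> 1 \<Longrightarrow>
        distr M (count_space UNIV) (\<xi> i l) = measure_pmf (map_pmf of_bool (bernoulli_pmf p))"

(* (on-hand inventory I_i, backorders B_{i-1}, outstanding orders [Q_{i-\<tau>}, ..., Q_{i-1}]) *)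
type_synonym state = "nat \<times> nat \<times> nat list"

definition sq_states :: "nat \<Rightarrow> nat \<Rightarrow> nat \<Rightarrow> state set" where
  "sq_states \<tau> s q =
     {(onhand, bo, Qs). length Qs = \<tau> \<and> onhand + sum_list Qs \<le> s + q \<and> onhand * bo = 0}"

(* Subtraction on nat truncates at 0, which is the positive part in the policy and in the dynamics. *)
fun sq_order :: "nat \<Rightarrow> nat \<Rightarrow> state \<Rightarrow> nat" where
  "sq_order s q (onhand, bo, Qs) = (s + q * of_bool (onhand = 0)) - (onhand + sum_list Qs)"

(* One period in which Q is ordered, the demand is dem, and the l-th unmet customer is
   backordered iff pat l = 1.  The order arriving in the period is hd (Qs @ [Q]); for lead
   time 0 (Qs = []) this is Q itself. *)
fun next_state :: "nat \<Rightarrow> nat \<Rightarrow> (nat \<Rightarrow> nat) \<Rightarrow> state \<Rightarrow> state" where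
  "next_state Q dem pat (onhand, bo, Qs) =
     (let arriving = hd (Qs @ [Q]);
          unmet = (bo + dem) - (onhand + arriving)
      in ((onhand + arriving) - (bo + dem), \<Sum>l=1..unmet. pat l, tl (Qs @ [Q])))"

(* sq_chain s q D \<xi> x i is X_i for i \<ge> 1, started from X_1 = x; the value at i = 0 is a dummy. *)
primrec sq_chain ::
  "nat \<Rightarrow> nat \<Rightarrow> (nat \<Rightarrow> 'w \<Rightarrow> nat) \<Rightarrow> (nat \<Rightarrow> nat \<Rightarrow> 'w \<Rightarrow> nat) \<Rightarrow> state \<Rightarrow> nat \<Rightarrow> 'w \<Rightarrow> state"
where
  "sq_chain s q D \<xi> x 0 \<omega> = x"
| "sq_chain s q D \<xi> x (Suc i) \<omega> =
     (if i = 0 then x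
      else next_state (sq_order s q (sq_chain s q D \<xi> x i \<omega>)) (D i \<omega>) (\<lambda>l. \<xi> i l \<omega>)
             (sq_chain s q D \<xi> x i \<omega>))"

(* P[X_i = y | X_1 = x] *)
definition sq_prob ::
  "'w measure \<Rightarrow> nat \<Rightarrow> nat \<Rightarrow> (nat \<Rightarrow> 'w \<Rightarrow> nat) \<Rightarrow> (nat \<Rightarrow> nat \<Rightarrow> 'w \<Rightarrow> nat) \<Rightarrow>
    nat \<Rightarrow> state \<Rightarrow> state \<Rightarrow> real"
where
  "sq_prob M s q D \<xi> i x y = measure M {\<omega> \<in> space M. sq_chain s q D \<xi> x i \<omega> = y}"

definition sq_kernel ::
  "'w measure \<Rightarrow> nat \<Rightarrow> nat \<Rightarrow> (nat \<Rightarrow> 'w \<Rightarrow> nat) \<Rightarrow> (nat \<Rightarrow> nat \<Rightarrow> 'w \<Rightarrow> nat) \<Rightarrow> state \<Rightarrow> state pmf"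
where
  "sq_kernel M s q D \<xi> x = embed_pmf (sq_prob M s q D \<xi> 2 x)"

primrec kernel_power :: "('a \<Rightarrow> 'a pmf) \<Rightarrow> nat \<Rightarrow> 'a \<Rightarrow> 'a pmf" where
  "kernel_power K 0 x = return_pmf x"
| "kernel_power K (Suc n) x = bind_pmf (kernel_power K n x) K"

(* The chain on S with transition kernel K has steady state distribution \<pi>, and its n-step
   distributions converge to \<pi> in total variation at a common geometric rate r, from every
   initial state. *)
definition geometrically_ergodic :: "'a set \<Rightarrow> ('a \<Rightarrow> 'a pmf) \<Rightarrow> 'a pmf \<Rightarrow> bool" where
  "geometrically_ergodic S K \<pi> \<longleftrightarrow>
     (\<forall>x\<in>S. set_pmf (K x) \<subseteq> S) \<and>
     set_pmf \<pi> \<subseteq> S \<and> bind_pmf \<pi> K = \<pi> \<and>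
     (\<exists>r::real. 0 < r \<and> r < 1 \<and>
        (\<forall>x\<in>S. \<exists>C::real. \<forall>n.
           (\<Sum>\<^sub>\<infinity>y\<in>S. \<bar>pmf (kernel_power K n x) y - pmf \<pi> y\<bar>) \<le> C * r ^ n))"

fun lyapunov :: "real \<Rightarrow> real \<Rightarrow> state \<Rightarrow> real" where
  "lyapunov p \<delta> (onhand, bo, Qs) = p * real bo powr \<delta> + 1"

end

(* Two copies of the chain, moved independently over blocks of N periods until they meet and together
   afterwards, are compared through the potential A + V x + V y off the diagonal.  For large V x + V y
   it contracts by the drift of V: since t |-> t powr \<delta> is concave, the conditional mean of B_i powr \<delta> given
   D_i is at most (p * (B_{i-1} + D_i)) powr \<delta>, which gives the factor p powr \<delta> < 1.  For bounded V x + V y it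
   contracts because both copies can reach one common state within N periods: with positive probability
   all unmet customers are lost, after which demands 0 and 1 steer the stock deterministically.
   Hence the n-step distributions are Cauchy in l1 at a geometric rate, uniformly in the number of
   further steps, which yields both the steady state and the bound; with \<theta> = \<rho> / 2 the factor 1 + \<beta>
   absorbs all constants. *)

theory Submission
  imports Defs
begin

section \<open>Harris' theorem for kernels on a discrete space\<close>

text \<open>The constants are quantified before the probability space, so they may use the law of
  the demand only through its mean, which enters the drift, and through the probabilities of the
  demands 0 and 1, which enter the minorization. For this reason the kernel is rebuilt as
  \<open>sq_pmf\<close>, a function of an arbitrary demand distribution, and both estimates hold for
  every demand law with these data. Backorders are unbounded, and for p = 0 the function V is
  constant, so a level set of V may be infinite. The minorization therefore passes through the
  finite set of states without backorders: with zero demand and b backorders, losing all unmet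
  customers has probability at least (1 - p)^b, which is bounded below on a level set for p = 0 as
  well as for p > 0. Different travel times are made equal by waiting at a state that zero demands
  leave unchanged; this also excludes periodicity. Independent copies are both at that state with
  probability at least the square of the minorization constant, so no residual kernel has to be
  split off. The weight A is the price of being apart: where V is small, the chance of meeting must
  pay for the additive constant of the drift.\<close>

lemma coupling_inequality:
  fixes \<gamma> :: "('a \<times> 'a) pmf"
  assumes "finite F"
  shows "(\<Sum>y\<in>F. \<bar>pmf (map_pmf fst \<gamma>) y - pmf (map_pmf snd \<gamma>) y\<bar>)
    \<le> 2 * measure (measure_pmf \<gamma>) {z. fst z \<noteq> snd z}"
proof -
  let ?P = "\<lambda>A. measure (measure_pmf \<gamma>) A"
  let ?a = "\<lambda>y. pmf (map_pmf fst \<gamma>) y" and ?b = "\<lambda>y. pmf (map_pmf snd \<gamma>) y"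
  \<comment> \<open>\<open>F\<close> is split by the sign of the difference of the marginals. On
    each half the absolute values add up to a difference of two probabilities of one set, and each
    such difference is at most the probability of disagreement.\<close>
  define G where "G = {y\<in>F. ?b y \<le> ?a y}"
  have G: "finite G" "finite (F - G)" "F = G \<union> (F - G)"
    using assms by (auto simp: G_def)
  have a: "(\<Sum>y\<in>H. ?a y) = ?P (fst -` H)" and b: "(\<Sum>y\<in>H. ?b y) = ?P (snd -` H)"
    if "finite H" for H
    using that by (simp_all add: measure_measure_pmf_finite[symmetric])
  have le: "?P (f -` H) \<le> ?P (g -` H) + ?P {z. fst z \<noteq> snd z}"
    if "(f, g) = (fst, snd) \<or> (f, g) = (snd, fst)" for f g :: "'a \<times> 'a \<Rightarrow> 'a" and H
  proof -
    have "?P (f -` H) \<le> ?P (g -` H \<union> {z. fst z \<noteq> snd z})"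
      using that by (intro measure_pmf.finite_measure_mono) auto
    also have "\<dots> \<le> ?P (g -` H) + ?P {z. fst z \<noteq> snd z}"
      by (intro measure_Un_le) auto
    finally show ?thesis .
  qed
  have "(\<Sum>y\<in>F. \<bar>?a y - ?b y\<bar>) = (\<Sum>y\<in>G. \<bar>?a y - ?b y\<bar>) + (\<Sum>y\<in>F - G. \<bar>?a y - ?b y\<bar>)"
    using G by (subst G(3), subst sum.union_disjoint) auto
  also have "\<dots> = (\<Sum>y\<in>G. ?a y - ?b y) + (\<Sum>y\<in>F - G. ?b y - ?a y)"
    by (intro arg_cong2[where f="(+)"] sum.cong) (auto simp: G_def)
  also have "\<dots> = ?P (fst -` G) - ?P (snd -` G) + (?P (snd -` (F - G)) - ?P (fst -` (F - G)))"
    using G a b by (simp add: sum_subtractf)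
  also have "\<dots> \<le> 2 * ?P {z. fst z \<noteq> snd z}"
    using le[of fst snd G] le[of snd fst "F - G"] by simp
  finally show ?thesis .
qed

lemma kernel_power_add:
  "kernel_power K (m + n) x = bind_pmf (kernel_power K m x) (kernel_power K n)"
  by (induction n) (simp_all add: bind_return_pmf' bind_assoc_pmf)

lemma kernel_power_closed:
  assumes "\<And>x. x \<in> S \<Longrightarrow> set_pmf (K x) \<subseteq> S" "x \<in> S"
  shows "set_pmf (kernel_power K n x) \<subseteq> S"
proof (induction n)
  case (Suc n)
  then show ?case using assms(1) by (fastforce simp: subset_iff)
qed (simp add: assms(2))

text \<open>Chapman-Kolmogorov with a single intermediate state kept; multiplied along a path it
  bounds the probability of the endpoint from below.\<close>

lemma pmf_bind_ge: "pmf \<mu> x * pmf (k x) y \<le> pmf (bind_pmf \<mu> k) y"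
proof -
  have "ennreal (pmf \<mu> x * pmf (k x) y)
      = (\<integral>\<^sup>+u. ennreal (pmf (k x) y) * indicator {x} u \<partial>measure_pmf \<mu>)"
    by (simp add: nn_integral_cmult_indicator emeasure_pmf_single ennreal_mult' mult.commute)
  also have "\<dots> \<le> (\<integral>\<^sup>+u. ennreal (pmf (k u) y) \<partial>measure_pmf \<mu>)"
    by (intro nn_integral_mono) (auto simp: indicator_def)
  finally show ?thesis
    by (simp add: ennreal_pmf_bind[symmetric])
qed

text \<open>The two regimes pull \<open>A\<close> in opposite directions. For s above
  \<open>R\<close> the drift alone must contract, and \<open>A\<close> is dead weight; for small s
  the possible meeting must beat \<open>2 * b\<close>, which needs \<open>A\<close> large. Any fixed
  \<open>A\<close> can be afforded in the first regime, at the cost of an \<open>r\<close> closer to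
  1.\<close>

lemma contraction_constants:
  fixes lam b R eps :: real
  assumes lam: "0 \<le> lam" "lam < 1" and b: "0 \<le> b" and eps: "0 < eps" "eps \<le> 1"
    and R: "0 < R" "4 * b \<le> (1 - lam) * R"
  obtains A r where "0 \<le> A" "0 < r" "r < 1"
    "\<And>s. R \<le> s \<Longrightarrow> A + (lam * s + 2 * b) \<le> r * (A + s)"
    "\<And>s. 0 \<le> s \<Longrightarrow> A * (1 - eps * eps) + (lam * s + 2 * b) \<le> r * (A + s)"
proof -
  \<comment> \<open>Half of the gain \<open>A * (eps * eps)\<close> cancels \<open>2 * b\<close>;
    the other half remains as contraction.\<close>
  define A where "A = 4 * b / (eps * eps)"
  define h where "h = (1 + lam) / 2"
  \<comment> \<open>For s at least \<open>R\<close>, \<open>lam * s + 2 * b\<close> is at most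
    \<open>h * s\<close>. The average \<open>r1\<close> of 1 and \<open>h\<close> with weights
    \<open>A\<close> and \<open>R\<close> then makes the bound an equality at s =
    \<open>R\<close>.\<close>
  define r1 where "r1 = (A + h * R) / (A + R)"
  define r where "r = max (1 - eps * eps / 2) r1"
  have A: "0 \<le> A" using b eps by (simp add: A_def)
  have h: "0 < h" "h < 1" "lam \<le> h" using lam by (auto simp: h_def)
  have "h * (A + R) \<le> A + h * R" using A h mult_right_mono[of h 1 A] by (simp add: algebra_simps)
  then have hr1: "h \<le> r1" using A R by (simp add: r1_def pos_le_divide_eq)
  have r1: "r1 < 1" using A R h by (simp add: r1_def)
  have r: "h \<le> r" "r < 1" "1 - eps * eps / 2 \<le> r" "r1 \<le> r"
    using hr1 r1 eps by (auto simp: r_def)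
  have far: "A + (lam * s + 2 * b) \<le> r * (A + s)" if "R \<le> s" for s
  proof -
    have "(1 - r) * A \<le> (1 - r1) * A" using r A by (intro mult_right_mono) auto
    also have "\<dots> = (r1 - h) * R"
      using A R by (simp add: r1_def field_simps)
    also have "\<dots> \<le> (r - h) * s"
      using that R r hr1 by (intro mult_mono) auto
    finally have 1: "(1 - r) * A \<le> (r - h) * s" .
    have "4 * b \<le> (1 - lam) * s"
      using R(2) mult_left_mono[OF that, of "1 - lam"] lam by linarith
    then have "lam * s + 2 * b \<le> h * s" by (simp add: h_def field_simps)
    with 1 show ?thesis by (simp add: algebra_simps)
  qed
  have near: "A * (1 - eps * eps) + (lam * s + 2 * b) \<le> r * (A + s)" if "0 \<le> s" for s
  proof -
    have "lam * s \<le> r * s" using that h r by (intro mult_right_mono) auto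
    moreover have "A * (1 - eps * eps / 2) \<le> A * r" using A r by (intro mult_left_mono) auto
    moreover have "A * (eps * eps) = 4 * b" using eps by (simp add: A_def)
    ultimately show ?thesis by (simp add: algebra_simps)
  qed
  show ?thesis using that[of A r] A r h far near by simp
qed

section \<open>Limits of distributions in l1: existence, total mass and invariance\<close>

lemma pmf_l1_limit:
  fixes P :: "nat \<Rightarrow> 'a pmf" and e :: "nat \<Rightarrow> real"
  assumes e: "e \<longlonglongrightarrow> 0"
    and cauchy: "\<And>n m F. finite F \<Longrightarrow> (\<Sum>w\<in>F. \<bar>pmf (P n) w - pmf (P (n + m)) w\<bar>) \<le> e n"
  obtains \<pi> where "\<And>w. (\<lambda>n. pmf (P n) w) \<longlonglongrightarrow> pmf \<pi> w"
proof -
  have "Cauchy (\<lambda>n. pmf (P n) w)" for w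
  proof (rule metric_CauchyI)
    fix \<epsilon> :: real assume "0 < \<epsilon>"
    with e have "eventually (\<lambda>n. e n < \<epsilon> / 2) sequentially"
      by (intro order_tendstoD) auto
    then obtain n where n: "e n < \<epsilon> / 2" by (auto simp: eventually_sequentially)
    have *: "\<bar>pmf (P n) w - pmf (P k) w\<bar> < \<epsilon> / 2" if "n \<le> k" for k
      using cauchy[of "{w}" n "k - n"] that n by simp
    have "dist (pmf (P k) w) (pmf (P l) w) < \<epsilon>" if "n \<le> k" "n \<le> l" for k l
      using *[OF that(1)] *[OF that(2)] unfolding dist_real_def by linarith
    then show "\<exists>M. \<forall>k\<ge>M. \<forall>l\<ge>M. dist (pmf (P k) w) (pmf (P l) w) < \<epsilon>" by blast
  qed
  then have "\<forall>w. \<exists>l. (\<lambda>n. pmf (P n) w) \<longlonglongrightarrow> l"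
    using Cauchy_convergent convergent_def by blast
  then obtain f where f: "(\<lambda>n. pmf (P n) w) \<longlonglongrightarrow> f w" for w by metis
  have f_nonneg: "0 \<le> f w" for w
    using f[of w] by (rule LIMSEQ_le_const) auto
  have f_le: "sum f F \<le> 1" if "finite F" for F
  proof (rule LIMSEQ_le_const2)
    show "(\<lambda>n. \<Sum>w\<in>F. pmf (P n) w) \<longlonglongrightarrow> sum f F" by (intro tendsto_sum f)
    show "\<exists>N. \<forall>n\<ge>N. (\<Sum>w\<in>F. pmf (P n) w) \<le> 1"
      using that by (auto simp: measure_measure_pmf_finite[symmetric])
  qed
  have summable: "f summable_on UNIV"
    using f_nonneg f_le
    by (intro nonneg_bounded_partial_sums_imp_summable_on[where C=1] eventually_finite_subsets_at_top_weakI) auto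
  have shift: "(\<lambda>m. pmf (P (n + m)) w) \<longlonglongrightarrow> f w" for n w
    using LIMSEQ_ignore_initial_segment[OF f[of w], of n] by (simp add: add.commute)
  \<comment> \<open>No mass escapes to infinity: on every finite set the l1 distance between
    \<open>P n\<close> and its pointwise limit \<open>f\<close> is at most \<open>e n\<close>, so
    \<open>f\<close> keeps mass at least 1 - \<open>e n\<close>.\<close>
  have le: "1 \<le> infsum f UNIV + e n" for n
  proof -
    have "(\<Sum>w\<in>F. pmf (P n) w) \<le> infsum f UNIV + e n" if F: "finite F" for F
    proof -
      have "(\<Sum>w\<in>F. \<bar>pmf (P n) w - f w\<bar>) \<le> e n"
      proof (rule LIMSEQ_le_const2)
        show "(\<lambda>m. \<Sum>w\<in>F. \<bar>pmf (P n) w - pmf (P (n + m)) w\<bar>) \<longlonglongrightarrow> (\<Sum>w\<in>F. \<bar>pmf (P n) w - f w\<bar>)"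
          by (intro tendsto_intros shift)
        show "\<exists>N. \<forall>m\<ge>N. (\<Sum>w\<in>F. \<bar>pmf (P n) w - pmf (P (n + m)) w\<bar>) \<le> e n"
          using cauchy[OF F] by blast
      qed
      moreover have "(\<Sum>w\<in>F. pmf (P n) w) \<le> (\<Sum>w\<in>F. f w + \<bar>pmf (P n) w - f w\<bar>)"
        by (intro sum_mono) auto
      moreover have "sum f F \<le> infsum f UNIV"
        using F summable f_nonneg by (intro finite_sum_le_infsum) auto
      ultimately show ?thesis by (simp add: sum.distrib)
    qed
    then have "infsum (pmf (P n)) UNIV \<le> infsum f UNIV + e n"
      using pmf_abs_summable[of "P n" UNIV]
      by (intro infsum_le_finite_sums) (auto simp: abs_summable_equivalent[symmetric] abs_summable_summable)
    then show ?thesis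
      using infsetsum_infsum[OF pmf_abs_summable[of "P n" UNIV]] infsetsum_pmf_eq_1[of "P n" UNIV] by simp
  qed
  have "(\<lambda>n. infsum f UNIV + e n) \<longlonglongrightarrow> infsum f UNIV + 0"
    by (intro tendsto_intros e)
  then have "1 \<le> infsum f UNIV"
    using LIMSEQ_le_const[of "\<lambda>n. infsum f UNIV + e n"] le by auto
  moreover have "infsum f UNIV \<le> 1"
    using summable f_le by (intro infsum_le_finite_sums)
  ultimately have "infsum f UNIV = 1" by simp
  moreover have "Infinite_Set_Sum.abs_summable_on f UNIV"
    using summable f_nonneg by (simp add: abs_summable_equivalent[symmetric])
  ultimately have "(\<integral>\<^sup>+w. ennreal (f w) \<partial>count_space UNIV) = 1"
    using nn_integral_conv_infsetsum[of f UNIV] infsetsum_infsum[of f UNIV] f_nonneg by simp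
  then have "pmf (embed_pmf f) w = f w" for w
    using f_nonneg by (intro pmf_embed_pmf) auto
  with f that[of "embed_pmf f"] show ?thesis by simp
qed

text \<open>Fatou's lemma gives only one inequality, \<open>bind_pmf \<pi> K\<close> below
  \<open>\<pi>\<close> pointwise. This suffices, since of two different probability mass functions
  neither lies below the other everywhere.\<close>

lemma invariant_limit:
  assumes lim: "\<And>w. (\<lambda>n. pmf (kernel_power K n x) w) \<longlonglongrightarrow> pmf \<pi> w"
  shows "bind_pmf \<pi> K = \<pi>"
proof (rule ccontr)
  assume "bind_pmf \<pi> K \<noteq> \<pi>"
  then obtain y where y: "pmf \<pi> y < pmf (bind_pmf \<pi> K) y"
    using pmf_neq_exists_less[of \<pi> "bind_pmf \<pi> K"] by auto
  have "(\<integral>\<^sup>+w. ennreal (pmf \<pi> w) * ennreal (pmf (K w) y) \<partial>count_space UNIV)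
      = (\<integral>\<^sup>+w. liminf (\<lambda>n. ennreal (pmf (kernel_power K n x) w) * ennreal (pmf (K w) y)) \<partial>count_space UNIV)"
  proof (intro nn_integral_cong)
    fix w
    have "(\<lambda>n. ennreal (pmf (kernel_power K n x) w * pmf (K w) y)) \<longlonglongrightarrow> ennreal (pmf \<pi> w * pmf (K w) y)"
      by (intro tendsto_intros lim)
    then show "ennreal (pmf \<pi> w) * ennreal (pmf (K w) y)
        = liminf (\<lambda>n. ennreal (pmf (kernel_power K n x) w) * ennreal (pmf (K w) y))"
      by (subst lim_imp_Liminf) (simp_all add: ennreal_mult[symmetric])
  qed
  also have "\<dots> \<le> liminf (\<lambda>n. \<integral>\<^sup>+w. ennreal (pmf (kernel_power K n x) w) * ennreal (pmf (K w) y) \<partial>count_space UNIV)"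
    by (intro nn_integral_liminf) auto
  also have "\<dots> = liminf (\<lambda>n. ennreal (pmf (kernel_power K (Suc n) x) y))"
    by (simp add: ennreal_pmf_bind nn_integral_measure_pmf)
  also have "\<dots> = ennreal (pmf \<pi> y)"
    using lim[of y, THEN LIMSEQ_Suc] by (intro lim_imp_Liminf tendsto_ennrealI) auto
  finally have "ennreal (pmf (bind_pmf \<pi> K) y) \<le> ennreal (pmf \<pi> y)"
    by (simp add: ennreal_pmf_bind nn_integral_measure_pmf)
  with y show False by (simp add: ennreal_le_iff)
qed

text \<open>The additive drift term is written \<open>(1 - lam) * b\<close> so that \<open>b\<close>
  is the fixed point of the affine map in the drift and iterates stay below
  \<open>lam * V x + b\<close>. \<open>A\<close> and \<open>r\<close> are parameters, tied to the
  drift by \<open>far\<close> and \<open>near\<close>, so that they can be chosen before the kernel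
  is known.\<close>

locale harris_kernel =
  fixes K :: "'a \<Rightarrow> 'a pmf" and S :: "'a set" and V :: "'a \<Rightarrow> real" and lam b R eps :: real
    and N :: nat and z :: 'a and A r :: real
  assumes closed: "x \<in> S \<Longrightarrow> set_pmf (K x) \<subseteq> S"
    and V_ge_1: "x \<in> S \<Longrightarrow> 1 \<le> V x"
    and lam: "0 \<le> lam" "lam < 1" and b: "0 \<le> b" and eps: "0 \<le> eps"
    and drift: "x \<in> S \<Longrightarrow> (\<integral>\<^sup>+y. ennreal (V y) \<partial>measure_pmf (K x)) \<le> ennreal (lam * V x + (1 - lam) * b)"
    and minorization: "x \<in> S \<Longrightarrow> V x \<le> R \<Longrightarrow> eps \<le> pmf (kernel_power K N x) z"
    and N_pos: "0 < N" and A: "0 \<le> A" and r: "0 < r" "r < 1"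
    and far: "R \<le> s \<Longrightarrow> A + (lam * s + 2 * b) \<le> r * (A + s)"
    and near: "0 \<le> s \<Longrightarrow> A * (1 - eps * eps) + (lam * s + 2 * b) \<le> r * (A + s)"
begin

section \<open>Contraction of the coupled copies and convergence\<close>

lemma power_closed: "x \<in> S \<Longrightarrow> set_pmf (kernel_power K n x) \<subseteq> S"
  using kernel_power_closed closed by metis

lemma V_nonneg: "x \<in> S \<Longrightarrow> 0 \<le> V x"
  using V_ge_1 by fastforce

lemma drift_power:
  assumes "x \<in> S"
  shows "(\<integral>\<^sup>+y. ennreal (V y) \<partial>measure_pmf (kernel_power K (Suc n) x)) \<le> ennreal (lam * V x + b)"
proof (induction n)
  case 0
  have "(1 - lam) * b \<le> b" using lam b by (simp add: algebra_simps)
  then have "ennreal (lam * V x + (1 - lam) * b) \<le> ennreal (lam * V x + b)"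
    by (intro ennreal_leI) simp
  with drift[OF assms] show ?case
    by (auto simp add: bind_return_pmf intro: order_trans)
next
  case (Suc n)
  let ?\<mu> = "kernel_power K (Suc n) x"
  have S: "y \<in> S" if "y \<in> set_pmf ?\<mu>" for y
    using power_closed[OF assms] that by blast
  have "(\<integral>\<^sup>+y. ennreal (V y) \<partial>measure_pmf (kernel_power K (Suc (Suc n)) x))
      = (\<integral>\<^sup>+y. \<integral>\<^sup>+u. ennreal (V u) \<partial>measure_pmf (K y) \<partial>measure_pmf ?\<mu>)"
    by (subst kernel_power.simps(2)) (subst nn_integral_bind_pmf, rule refl)
  also have "\<dots> \<le> (\<integral>\<^sup>+y. ennreal lam * ennreal (V y) + ennreal ((1 - lam) * b) \<partial>measure_pmf ?\<mu>)"
    using lam b S V_nonneg drift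
    by (intro nn_integral_mono_AE)
       (auto simp: AE_measure_pmf_iff ennreal_mult[symmetric] ennreal_plus[symmetric] simp del: ennreal_plus kernel_power.simps)
  also have "\<dots> = ennreal lam * (\<integral>\<^sup>+y. ennreal (V y) \<partial>measure_pmf ?\<mu>) + ennreal ((1 - lam) * b)"
    by (simp add: nn_integral_add nn_integral_cmult)
  also have "\<dots> \<le> ennreal lam * ennreal (lam * V x + b) + ennreal ((1 - lam) * b)"
    using Suc.IH by (intro add_right_mono mult_left_mono) auto
  also have "\<dots> = ennreal (lam * (lam * V x + b) + (1 - lam) * b)"
    using lam b V_nonneg[OF assms] by (simp add: ennreal_mult[symmetric] ennreal_plus[symmetric] del: ennreal_plus)
  also have "\<dots> \<le> ennreal (lam * V x + b)"
  proof (rule ennreal_leI)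
    have "lam * (lam * V x) \<le> 1 * (lam * V x)"
      using lam V_nonneg[OF assms] by (intro mult_right_mono) auto
    then show "lam * (lam * V x + b) + (1 - lam) * b \<le> lam * V x + b"
      by (simp add: algebra_simps)
  qed
  finally show ?case .
qed

text \<open>Time 0 is included and the bound does not grow with \<open>n\<close>; this is the source
  of the uniformity in \<open>m\<close> in \<open>l1_distance\<close>.\<close>

lemma moment_power:
  assumes "x \<in> S"
  shows "(\<integral>\<^sup>+y. ennreal (V y) \<partial>measure_pmf (kernel_power K n x)) \<le> ennreal (V x + b)"
proof (cases n)
  case 0
  then show ?thesis using b V_nonneg[OF assms] by (auto intro!: ennreal_leI)
next
  case (Suc m)
  have "lam * V x \<le> 1 * V x"
    using lam V_nonneg[OF assms] by (intro mult_right_mono) auto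
  then show ?thesis
    using drift_power[OF assms, of m] Suc by (auto intro!: ennreal_leI elim!: order_trans)
qed

text \<open>As \<open>V\<close> is at least 1 on \<open>S\<close>, the potential is at least 2 off
  the diagonal, so its expectation dominates the right-hand side of
  \<open>coupling_inequality\<close>.\<close>

definition potential :: "'a \<times> 'a \<Rightarrow> ennreal" where
  "potential u = (if fst u = snd u then 0 else ennreal (A + (V (fst u) + V (snd u))))"

definition coupling_step :: "'a \<times> 'a \<Rightarrow> ('a \<times> 'a) pmf" where
  "coupling_step u =
     (if fst u = snd u then map_pmf (\<lambda>a. (a, a)) (kernel_power K N (fst u))
      else pair_pmf (kernel_power K N (fst u)) (kernel_power K N (snd u)))"

lemma potential_pair:
  assumes "set_pmf \<mu> \<subseteq> S" "set_pmf \<nu> \<subseteq> S"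
  shows "(\<integral>\<^sup>+u. potential u \<partial>measure_pmf (pair_pmf \<mu> \<nu>))
    \<le> ennreal (A * measure (measure_pmf (pair_pmf \<mu> \<nu>)) {u. fst u \<noteq> snd u})
      + ((\<integral>\<^sup>+y. ennreal (V y) \<partial>measure_pmf \<mu>) + (\<integral>\<^sup>+y. ennreal (V y) \<partial>measure_pmf \<nu>))"
proof -
  let ?\<gamma> = "pair_pmf \<mu> \<nu>"
  have "(\<integral>\<^sup>+u. potential u \<partial>measure_pmf ?\<gamma>)
    \<le> (\<integral>\<^sup>+u. ennreal A * indicator {u. fst u \<noteq> snd u} u + (ennreal (V (fst u)) + ennreal (V (snd u)))
        \<partial>measure_pmf ?\<gamma>)"
    using assms A V_nonneg
    by (intro nn_integral_mono_AE)
       (auto simp: AE_measure_pmf_iff potential_def subset_iff)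
  also have "\<dots> = ennreal A * emeasure ?\<gamma> {u. fst u \<noteq> snd u}
      + ((\<integral>\<^sup>+u. ennreal (V (fst u)) \<partial>measure_pmf ?\<gamma>) + (\<integral>\<^sup>+u. ennreal (V (snd u)) \<partial>measure_pmf ?\<gamma>))"
    by (simp add: nn_integral_add nn_integral_cmult_indicator)
  also have "(\<integral>\<^sup>+u. ennreal (V (fst u)) \<partial>measure_pmf ?\<gamma>) = (\<integral>\<^sup>+y. ennreal (V y) \<partial>measure_pmf \<mu>)"
    by (simp add: nn_integral_pair_pmf')
  also have "(\<integral>\<^sup>+u. ennreal (V (snd u)) \<partial>measure_pmf ?\<gamma>) = (\<integral>\<^sup>+y. ennreal (V y) \<partial>measure_pmf \<nu>)"
    by (simp add: nn_integral_pair_pmf')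
  finally show ?thesis
    using A by (simp add: measure_pmf.emeasure_eq_measure ennreal_mult')
qed

lemma potential_coupling_step:
  assumes "fst u \<in> S" "snd u \<in> S"
  shows "(\<integral>\<^sup>+v. potential v \<partial>measure_pmf (coupling_step u)) \<le> ennreal r * potential u"
proof (cases "fst u = snd u")
  case True
  then show ?thesis by (simp add: coupling_step_def potential_def)
next
  case False
  obtain x y where u: "u = (x, y)" by (cases u)
  with assms False have xy: "x \<in> S" "y \<in> S" "x \<noteq> y" by auto
  let ?\<mu> = "kernel_power K N x" and ?\<nu> = "kernel_power K N y"
  let ?m = "measure (measure_pmf (pair_pmf ?\<mu> ?\<nu>)) {u. fst u \<noteq> snd u}"
  define s where "s = V x + V y"
  have s: "0 \<le> s" using V_nonneg xy by (simp add: s_def)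
  have "(\<integral>\<^sup>+v. potential v \<partial>measure_pmf (coupling_step u))
      \<le> ennreal (A * ?m) + (ennreal (lam * V x + b) + ennreal (lam * V y + b))"
  proof -
    have "(\<integral>\<^sup>+v. ennreal (V v) \<partial>measure_pmf (kernel_power K N w)) \<le> ennreal (lam * V w + b)"
      if "w \<in> S" for w
      using drift_power[OF that, of "N - 1"] N_pos by (simp del: kernel_power.simps)
    then show ?thesis
      using xy potential_pair[OF power_closed power_closed, of x y N N]
      by (auto simp: coupling_step_def u intro!: add_mono elim!: order_trans)
  qed
  also have "\<dots> = ennreal (A * ?m + (lam * s + 2 * b))"
    using A lam b xy V_nonneg by (simp add: s_def algebra_simps ennreal_plus[symmetric] del: ennreal_plus)
  also have "\<dots> \<le> ennreal (r * (A + s))"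
  proof (rule ennreal_leI, cases "R \<le> s")
    case True
    have "A * ?m \<le> A * 1" using A by (intro mult_left_mono) auto
    with far[OF True] show "A * ?m + (lam * s + 2 * b) \<le> r * (A + s)" by simp
  next
    \<comment> \<open>The sum \<open>s\<close> is below \<open>R\<close>, hence so is each summand,
      and both copies are at \<open>z\<close> after the block with probability at least
      \<open>eps * eps\<close> by independence.\<close>
    case False
    then have "V x \<le> R" "V y \<le> R" using V_nonneg xy by (fastforce simp: s_def)+
    then have "eps * eps \<le> pmf ?\<mu> z * pmf ?\<nu> z"
      using minorization xy eps by (intro mult_mono) auto
    also have "\<dots> = measure (pair_pmf ?\<mu> ?\<nu>) {(z, z)}"
      by (simp add: pmf_pair measure_pmf_single)
    also have "\<dots> \<le> measure (pair_pmf ?\<mu> ?\<nu>) (UNIV - {u. fst u \<noteq> snd u})"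
      by (intro measure_pmf.finite_measure_mono) auto
    also have "\<dots> = 1 - ?m"
      using measure_pmf.prob_compl[of "{u. fst u \<noteq> snd u}" "pair_pmf ?\<mu> ?\<nu>"] by simp
    finally have "A * ?m \<le> A * (1 - eps * eps)"
      using A by (intro mult_left_mono) auto
    with near[OF s] show "A * ?m + (lam * s + 2 * b) \<le> r * (A + s)" by simp
  qed
  also have "\<dots> = ennreal r * potential u"
    using r A s xy by (simp add: potential_def u s_def ennreal_mult')
  finally show ?thesis .
qed

lemma marginals_coupling_step:
  "map_pmf fst (coupling_step u) = kernel_power K N (fst u)"
  "map_pmf snd (coupling_step u) = kernel_power K N (snd u)"
  by (simp_all add: coupling_step_def pmf.map_comp o_def map_fst_pair_pmf map_snd_pair_pmf)

lemma marginals_coupling: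
  "map_pmf fst (kernel_power coupling_step n u) = kernel_power K (n * N) (fst u)"
  "map_pmf snd (kernel_power coupling_step n u) = kernel_power K (n * N) (snd u)"
  by (induction n)
     (simp_all add: map_bind_pmf marginals_coupling_step bind_map_pmf[symmetric] kernel_power_add[symmetric] add.commute)

lemma coupling_closed:
  assumes "u \<in> S \<times> S"
  shows "set_pmf (kernel_power coupling_step n u) \<subseteq> S \<times> S"
proof -
  have "fst ` set_pmf (kernel_power coupling_step n u) \<subseteq> S"
    unfolding set_map_pmf[symmetric] marginals_coupling using assms by (intro power_closed) auto
  moreover have "snd ` set_pmf (kernel_power coupling_step n u) \<subseteq> S"
    unfolding set_map_pmf[symmetric] marginals_coupling using assms by (intro power_closed) auto
  ultimately show ?thesis by (auto simp: image_subset_iff)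
qed

lemma potential_coupling:
  assumes "u \<in> S \<times> S"
  shows "(\<integral>\<^sup>+v. potential v \<partial>measure_pmf (kernel_power coupling_step n u)) \<le> ennreal (r ^ n) * potential u"
proof (induction n)
  case (Suc n)
  have "(\<integral>\<^sup>+v. potential v \<partial>measure_pmf (kernel_power coupling_step (Suc n) u))
      \<le> (\<integral>\<^sup>+v. ennreal r * potential v \<partial>measure_pmf (kernel_power coupling_step n u))"
    using coupling_closed[OF assms, of n] potential_coupling_step
    by (auto simp: AE_measure_pmf_iff subset_iff intro!: nn_integral_mono_AE)
  also have "\<dots> \<le> ennreal r * (ennreal (r ^ n) * potential u)"
    by (subst nn_integral_cmult) (auto intro: mult_left_mono Suc.IH)
  also have "\<dots> = ennreal (r ^ Suc n) * potential u"
    using r by (simp add: ennreal_mult' mult.assoc)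
  finally show ?case .
qed simp

definition rate :: real where "rate = root N r"

lemma rate: "0 < rate" "rate < 1" "rate ^ N = r"
  using r N_pos by (auto simp: rate_def)

text \<open>Rounding \<open>n\<close> down to complete blocks costs at most one factor
  \<open>r\<close>, since fewer than \<open>N\<close> periods are left over.\<close>

lemma rate_power: "r ^ (n div N) \<le> rate ^ n / r"
proof -
  have "r \<le> rate ^ (n mod N)"
    using rate(1,2) N_pos power_decreasing[of "n mod N" N rate] by (simp add: rate(3) less_imp_le)
  then have "r * r ^ (n div N) \<le> rate ^ (n mod N) * r ^ (n div N)"
    using r by (intro mult_right_mono) auto
  also have "\<dots> = rate ^ (N * (n div N) + n mod N)"
    by (simp only: power_add power_mult rate(3) mult.commute)
  finally show ?thesis using r by (simp add: field_simps)
qed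

lemma l1_distance:
  assumes "x \<in> S" "y \<in> S" "finite F"
  shows "(\<Sum>w\<in>F. \<bar>pmf (kernel_power K n x) w - pmf (kernel_power K (n + m) y) w\<bar>)
    \<le> (A + 2 * b + 1) / r * (V x + V y) * rate ^ n"
proof -
  define k where "k = n div N"
  \<comment> \<open>The incomplete block, and for the second copy the \<open>m\<close> extra
    periods, are run first; both copies then have exactly \<open>k\<close> complete blocks
    ahead.\<close>
  define j where "j = n mod N"
  have n: "n = j + k * N" and nm: "n + m = (m + j) + k * N" by (auto simp: k_def j_def)
  let ?\<mu> = "kernel_power K j x" and ?\<nu> = "kernel_power K (m + j) y"
  define \<gamma> where "\<gamma> = bind_pmf (pair_pmf ?\<mu> ?\<nu>) (kernel_power coupling_step k)"
  have fst: "map_pmf fst \<gamma> = kernel_power K n x"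
    unfolding n \<gamma>_def
    by (simp add: map_bind_pmf marginals_coupling kernel_power_add map_fst_pair_pmf
      bind_map_pmf[of fst, symmetric])
  have snd: "map_pmf snd \<gamma> = kernel_power K (n + m) y"
    unfolding nm \<gamma>_def kernel_power_add[of _ "m + j"]
    by (simp add: map_bind_pmf marginals_coupling map_snd_pair_pmf
      bind_map_pmf[of snd, symmetric])
  have set: "set_pmf (pair_pmf ?\<mu> ?\<nu>) \<subseteq> S \<times> S"
    using power_closed assms by auto
  then have set': "set_pmf \<gamma> \<subseteq> S \<times> S"
    unfolding \<gamma>_def set_bind_pmf by (intro UN_least coupling_closed) blast
  have s: "1 \<le> V x + V y" using V_ge_1[OF assms(1)] V_ge_1[OF assms(2)] by simp
  have "ennreal (2 * measure \<gamma> {u. fst u \<noteq> snd u})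
      = (\<integral>\<^sup>+u. 2 * indicator {u. fst u \<noteq> snd u} u \<partial>measure_pmf \<gamma>)"
    by (simp add: nn_integral_cmult_indicator measure_pmf.emeasure_eq_measure ennreal_mult')
  also have "\<dots> \<le> (\<integral>\<^sup>+u. potential u \<partial>measure_pmf \<gamma>)"
  proof (intro nn_integral_mono_AE, unfold AE_measure_pmf_iff, safe)
    fix a b assume "(a, b) \<in> set_pmf \<gamma>"
    with set' have "a \<in> S" "b \<in> S" by blast+
    then have "1 \<le> V a" "1 \<le> V b" by (auto intro: V_ge_1)
    then have "ennreal 2 \<le> ennreal (A + (V a + V b))" using A by (intro ennreal_leI) auto
    then show "2 * indicator {u. fst u \<noteq> snd u} (a, b) \<le> potential (a, b)"
      by (auto simp: potential_def)
  qed
  also have "\<dots> \<le> (\<integral>\<^sup>+u. ennreal (r ^ k) * potential u \<partial>measure_pmf (pair_pmf ?\<mu> ?\<nu>))"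
    unfolding \<gamma>_def nn_integral_bind_pmf using set potential_coupling
    by (intro nn_integral_mono_AE) (auto simp: AE_measure_pmf_iff)
  also have "\<dots> = ennreal (r ^ k) * (\<integral>\<^sup>+u. potential u \<partial>measure_pmf (pair_pmf ?\<mu> ?\<nu>))"
    by (subst nn_integral_cmult) auto
  also have "\<dots> \<le> ennreal (r ^ k) * (ennreal (A * 1) + (ennreal (V x + b) + ennreal (V y + b)))"
  proof (rule mult_left_mono)
    have "A * measure (pair_pmf ?\<mu> ?\<nu>) {u. fst u \<noteq> snd u} \<le> A * 1"
      using A by (intro mult_left_mono) auto
    then show "(\<integral>\<^sup>+u. potential u \<partial>measure_pmf (pair_pmf ?\<mu> ?\<nu>))
        \<le> ennreal (A * 1) + (ennreal (V x + b) + ennreal (V y + b))"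
      using assms
      by (rule_tac order_trans[OF potential_pair[OF power_closed power_closed]])
         (auto intro: add_mono moment_power ennreal_leI)
  qed simp
  also have "\<dots> = ennreal (r ^ k * (A + 2 * b + (V x + V y)))"
    using A b V_nonneg[OF assms(1)] V_nonneg[OF assms(2)] r
    by (simp add: ennreal_mult[symmetric] ennreal_plus[symmetric] add_ac del: ennreal_plus)
  also have "\<dots> \<le> ennreal (rate ^ n / r * ((A + 2 * b + 1) * (V x + V y)))"
  proof (intro ennreal_leI mult_mono)
    have "(A + 2 * b) * 1 \<le> (A + 2 * b) * (V x + V y)"
      using A b s by (intro mult_left_mono) auto
    then show "A + 2 * b + (V x + V y) \<le> (A + 2 * b + 1) * (V x + V y)"
      by (simp add: algebra_simps)
  qed (use A b s r rate rate_power[of n] in \<open>simp_all add: k_def\<close>)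
  finally have "2 * measure \<gamma> {u. fst u \<noteq> snd u} \<le> rate ^ n / r * ((A + 2 * b + 1) * (V x + V y))"
    using A b s r rate by (subst (asm) ennreal_le_iff) auto
  with coupling_inequality[OF assms(3), of \<gamma>] show ?thesis
    unfolding fst snd by (simp add: mult_ac)
qed

text \<open>The limit is taken along the single start \<open>x0\<close>. For another start the
  time-n law is compared with that of \<open>x0\<close> at time n + m, and m tends to
  infinity.\<close>

theorem ergodic:
  assumes x0: "x0 \<in> S"
  obtains \<pi> where "set_pmf \<pi> \<subseteq> S" "bind_pmf \<pi> K = \<pi>"
    "\<forall>x\<in>S. \<forall>n F. finite F \<longrightarrow>
      (\<Sum>w\<in>F. \<bar>pmf (kernel_power K n x) w - pmf \<pi> w\<bar>) \<le> (A + 2 * b + 1) / r * (V x + V x0) * rate ^ n"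
proof -
  have "(\<lambda>n. (A + 2 * b + 1) / r * (V x0 + V x0) * rate ^ n) \<longlonglongrightarrow> (A + 2 * b + 1) / r * (V x0 + V x0) * 0"
    using rate by (intro tendsto_mult tendsto_const LIMSEQ_realpow_zero) auto
  then have lim0: "(\<lambda>n. (A + 2 * b + 1) / r * (V x0 + V x0) * rate ^ n) \<longlonglongrightarrow> 0" by simp
  obtain \<pi> where lim: "\<And>w. (\<lambda>n. pmf (kernel_power K n x0) w) \<longlonglongrightarrow> pmf \<pi> w"
    using pmf_l1_limit[OF lim0, of "\<lambda>n. kernel_power K n x0"] l1_distance[OF x0 x0] by blast
  have "set_pmf \<pi> \<subseteq> S"
  proof
    fix w assume w: "w \<in> set_pmf \<pi>"
    show "w \<in> S"
    proof (rule ccontr)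
      assume "w \<notin> S"
      then have "pmf (kernel_power K n x0) w = 0" for n
        using power_closed[OF x0, of n] by (auto simp: pmf_eq_0_set_pmf)
      then have "(\<lambda>n. 0) \<longlonglongrightarrow> pmf \<pi> w" using lim[of w] by simp
      then have "pmf \<pi> w = 0" using LIMSEQ_unique tendsto_const by blast
      with w show False by (simp add: set_pmf_iff)
    qed
  qed
  moreover have "(\<Sum>w\<in>F. \<bar>pmf (kernel_power K n x) w - pmf \<pi> w\<bar>)
      \<le> (A + 2 * b + 1) / r * (V x + V x0) * rate ^ n" if "x \<in> S" "finite F" for x n F
  proof (rule LIMSEQ_le_const2)
    have "(\<lambda>m. pmf (kernel_power K (n + m) x0) w) \<longlonglongrightarrow> pmf \<pi> w" for w
      using LIMSEQ_ignore_initial_segment[OF lim[of w], of n] by (simp add: add.commute)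
    then show "(\<lambda>m. \<Sum>w\<in>F. \<bar>pmf (kernel_power K n x) w - pmf (kernel_power K (n + m) x0) w\<bar>)
        \<longlonglongrightarrow> (\<Sum>w\<in>F. \<bar>pmf (kernel_power K n x) w - pmf \<pi> w\<bar>)"
      by (intro tendsto_intros)
    show "\<exists>M. \<forall>m\<ge>M. (\<Sum>w\<in>F. \<bar>pmf (kernel_power K n x) w - pmf (kernel_power K (n + m) x0) w\<bar>)
        \<le> (A + 2 * b + 1) / r * (V x + V x0) * rate ^ n"
      using l1_distance[OF that(1) x0 that(2)] by blast
  qed
  ultimately show ?thesis using that invariant_limit[OF lim] by blast
qed

end

section \<open>The kernel of the \<open>(s, q)\<close>-policy\<close>

fun unmet_demand :: "nat \<Rightarrow> nat \<Rightarrow> state \<Rightarrow> nat \<Rightarrow> nat" where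
  "unmet_demand s q (onhand, bo, Qs) k =
     (bo + k) - (onhand + hd (Qs @ [sq_order s q (onhand, bo, Qs)]))"

fun successor :: "nat \<Rightarrow> nat \<Rightarrow> state \<Rightarrow> nat \<Rightarrow> nat \<Rightarrow> state" where
  "successor s q (onhand, bo, Qs) k m =
     (let Q = sq_order s q (onhand, bo, Qs)
      in ((onhand + hd (Qs @ [Q])) - (bo + k), m, tl (Qs @ [Q])))"

lemma next_state_successor:
  "next_state (sq_order s q x) k pat x = successor s q x k (\<Sum>l=1..unmet_demand s q x k. pat l)"
  by (cases x) (simp add: Let_def)

text \<open>The patience of individual customers matters only through the number of those who stay,
  which is binomial given the number of unmet customers. The kernel thus needs the demand law alone
  and no sample space.\<close>

definition sq_pmf :: "nat \<Rightarrow> nat \<Rightarrow> real \<Rightarrow> nat pmf \<Rightarrow> state \<Rightarrow> state pmf" where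
  "sq_pmf s q p dem x =
     bind_pmf dem (\<lambda>k. map_pmf (successor s q x k) (binomial_pmf (unmet_demand s q x k) p))"

lemma hd_plus_sum_tl: "hd (xs @ [y]) + sum_list (tl (xs @ [y])) = sum_list xs + (y :: nat)"
  by (cases xs) auto

text \<open>Remaining stock and unmet demand are opposite truncated differences, so at least one of
  them is 0, and \<open>m\<close> vanishes with the latter. For the capacity bound, an order never
  lifts stock plus pipeline above s + q, and an arrival only moves units between the two.\<close>

lemma successor_in_sq_states:
  assumes x: "x \<in> sq_states \<tau> s q" and m: "m \<le> unmet_demand s q x k"
  shows "successor s q x k m \<in> sq_states \<tau> s q"
proof -
  obtain i b Qs where [simp]: "x = (i, b, Qs)" by (cases x)
  have "sum_list Qs + i \<le> s + q" "length Qs = \<tau>" using x by (auto simp: sq_states_def)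
  moreover have "sq_order s q x + (i + sum_list Qs) \<le> s + q"
    using calculation by (auto simp: of_bool_def)
  ultimately show ?thesis
    using m hd_plus_sum_tl[of Qs "sq_order s q x"]
    by (auto simp: sq_states_def Let_def simp del: sq_order.simps)
qed

lemma sq_pmf_closed:
  assumes "0 \<le> p" "p \<le> 1" "x \<in> sq_states \<tau> s q"
  shows "set_pmf (sq_pmf s q p dem x) \<subseteq> sq_states \<tau> s q"
  using assms by (auto simp: sq_pmf_def set_pmf_binomial_eq split: if_splits intro!: successor_in_sq_states)

section \<open>Drift of powers of the backorders under binomial thinning\<close>

lemma nn_integral_binomial_mean:
  assumes "0 \<le> p" "p \<le> 1"
  shows "(\<integral>\<^sup>+m. ennreal (real m) \<partial>binomial_pmf n p) = ennreal (real n * p)"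
proof (induction n)
  case 0
  then show ?case using assms by (simp add: binomial_pmf_0)
next
  case (Suc n)
  have *: "(\<integral>\<^sup>+m. ennreal (c + real m) \<partial>binomial_pmf n p) = ennreal (c + real n * p)" if "0 \<le> c" for c
    using that assms Suc.IH by (simp add: nn_integral_add)
  have "ennreal (1 + real n * p) * ennreal p + ennreal (0 + real n * p) * ennreal (1 - p)
      = ennreal ((1 + real n * p) * p + (0 + real n * p) * (1 - p))"
    using assms by (simp add: ennreal_mult[symmetric] ennreal_plus[symmetric] del: ennreal_plus)
  then show ?case
    using assms *[of 1] *[of 0] by (simp add: binomial_pmf_Suc algebra_simps)
qed

text \<open>Concavity: the right-hand side is the tangent at \<open>M\<close>. It comes from Young's
  inequality, that is weighted AM-GM, for t / M and 1.\<close>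

lemma powr_tangent:
  fixes t M \<delta> :: real
  assumes "0 \<le> t" "0 < M" "0 < \<delta>" "\<delta> \<le> 1"
  shows "t powr \<delta> \<le> M powr \<delta> * (1 - \<delta> + \<delta> * (t / M))"
proof (cases "t = 0")
  case False
  then have "(t / M) powr \<delta> * 1 powr (1 - \<delta>) \<le> \<delta> * (t / M) + (1 - \<delta>) * 1"
    using assms by (intro Youngs_inequality_0) auto
  then have "M powr \<delta> * (t / M) powr \<delta> \<le> M powr \<delta> * (1 - \<delta> + \<delta> * (t / M))"
    by (intro mult_left_mono) auto
  then show ?thesis using assms by (simp add: powr_divide)
qed (use assms in auto)

text \<open>Jensen's inequality, obtained by integrating the tangent at the mean. Mean 0 is treated
  separately, as the tangent exists only at a positive point.\<close>

lemma nn_integral_binomial_powr: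
  assumes p: "0 \<le> p" "p \<le> 1" and \<delta>: "0 < \<delta>" "\<delta> \<le> 1"
  shows "(\<integral>\<^sup>+m. ennreal (real m powr \<delta>) \<partial>binomial_pmf n p) \<le> ennreal ((real n * p) powr \<delta>)"
proof (cases "real n * p = 0")
  case True
  then have "set_pmf (binomial_pmf n p) = {0}" using p by (auto simp: set_pmf_binomial_eq)
  then have "(\<integral>\<^sup>+m. ennreal (real m powr \<delta>) \<partial>binomial_pmf n p) = (\<integral>\<^sup>+m. 0 \<partial>binomial_pmf n p)"
    by (intro nn_integral_cong_AE) (auto simp: AE_measure_pmf_iff)
  then show ?thesis by simp
next
  case False
  define M where "M = real n * p"
  have "0 \<le> M" "M \<noteq> 0" using False p by (simp_all add: M_def)
  then have M: "0 < M" by linarith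
  let ?c = "M powr \<delta> * (1 - \<delta>)" and ?e = "M powr \<delta> * \<delta> / M"
  have c: "0 \<le> ?c" "0 \<le> ?e" using \<delta> M by auto
  have "(\<integral>\<^sup>+m. ennreal (real m powr \<delta>) \<partial>binomial_pmf n p)
      \<le> (\<integral>\<^sup>+m. ennreal ?c + ennreal ?e * ennreal (real m) \<partial>binomial_pmf n p)"
  proof (intro nn_integral_mono)
    fix m :: nat
    have le: "real m powr \<delta> \<le> ?c + ?e * real m"
      using powr_tangent[of "real m" M \<delta>] \<delta> M by (simp add: algebra_simps)
    have "ennreal ?c + ennreal ?e * ennreal (real m) = ennreal (?c + ?e * real m)"
      by (simp only: ennreal_mult[OF c(2) of_nat_0_le_iff] ennreal_plus[OF c(1) mult_nonneg_nonneg[OF c(2) of_nat_0_le_iff]])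
    with le show "ennreal (real m powr \<delta>) \<le> ennreal ?c + ennreal ?e * ennreal (real m)"
      by (simp only: ennreal_leI)
  qed
  also have "\<dots> = ennreal ?c + ennreal ?e * ennreal M"
    using p by (simp add: nn_integral_add nn_integral_cmult nn_integral_binomial_mean M_def)
  also have "\<dots> = ennreal (?c + ?e * M)"
    by (simp only: ennreal_mult[OF c(2) less_imp_le[OF M]] ennreal_plus[OF c(1) mult_nonneg_nonneg[OF c(2) less_imp_le[OF M]]])
  also have "?c + ?e * M = M powr \<delta>"
    using M by (simp add: field_simps)
  finally show ?thesis by (simp add: M_def)
qed

lemma nat_powr_le:
  assumes "0 < \<delta>" "\<delta> \<le> 1"
  shows "real n powr \<delta> \<le> real n"
  using assms powr_mono[of \<delta> 1 "real n"] by (cases n) auto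

text \<open>For n at least 1 the tangent at n has slope at most 1. New demand therefore costs at
  most a linear term, and the drift needs no more than the mean of the demand.\<close>

lemma nat_powr_add_le:
  assumes \<delta>: "0 < \<delta>" "\<delta> \<le> 1"
  shows "real (n + k) powr \<delta> \<le> real n powr \<delta> + real k"
proof (cases "n = 0")
  case True
  then show ?thesis using nat_powr_le[OF \<delta>] by simp
next
  case False
  have "real (n + k) powr \<delta> \<le> real n powr \<delta> * (1 - \<delta> + \<delta> * (real (n + k) / real n))"
    using False \<delta> by (intro powr_tangent) auto
  also have "\<dots> = real n powr \<delta> + \<delta> * (real n powr \<delta> / real n) * real k"
    using False by (simp add: field_simps)
  also have "\<dots> \<le> real n powr \<delta> + 1 * 1 * real k"
    using False \<delta> nat_powr_le[OF \<delta>, of n]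
    by (intro add_left_mono mult_right_mono mult_mono) auto
  finally show ?thesis by simp
qed

text \<open>Stock can only reduce the unmet demand, so it is at most b + k. Thinning by p
  contributes the factor \<open>p powr \<delta>\<close>, and \<open>nat_powr_add_le\<close>
  separates the old backorders from the demand.\<close>

lemma sq_pmf_drift:
  assumes p: "0 \<le> p" "p < 1" and \<delta>: "0 < \<delta>" "\<delta> \<le> 1" and d: "0 \<le> d"
    and mean: "(\<integral>\<^sup>+k. ennreal (real k) \<partial>measure_pmf dem) = ennreal d"
  shows "(\<integral>\<^sup>+y. ennreal (lyapunov p \<delta> y) \<partial>measure_pmf (sq_pmf s q p dem x))
    \<le> ennreal (p powr \<delta> * lyapunov p \<delta> x + (d + 1))"
proof -
  obtain i b Qs where x: "x = (i, b, Qs)" by (cases x)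
  have lam: "p powr \<delta> \<le> 1" using p \<delta> by (simp add: powr_le1)
  define C where "C = p powr \<delta> * (p * real b powr \<delta>) + 1"
  have C: "0 \<le> C" using p by (simp add: C_def)
  have step: "(\<integral>\<^sup>+m. ennreal (lyapunov p \<delta> (successor s q x k m)) \<partial>binomial_pmf (unmet_demand s q x k) p)
      \<le> ennreal C + ennreal (real k)" for k
  proof -
    let ?U = "unmet_demand s q x k"
    have "(\<integral>\<^sup>+m. ennreal (lyapunov p \<delta> (successor s q x k m)) \<partial>binomial_pmf ?U p)
        = (\<integral>\<^sup>+m. ennreal p * ennreal (real m powr \<delta>) + 1 \<partial>binomial_pmf ?U p)"
      using p by (simp add: x Let_def ennreal_mult)
    also have "\<dots> = ennreal p * (\<integral>\<^sup>+m. ennreal (real m powr \<delta>) \<partial>binomial_pmf ?U p) + 1"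
      by (simp add: nn_integral_add nn_integral_cmult)
    also have "\<dots> \<le> ennreal p * ennreal ((real ?U * p) powr \<delta>) + 1"
      using p \<delta> by (intro add_right_mono mult_left_mono nn_integral_binomial_powr) auto
    also have "\<dots> = ennreal (p * (real ?U * p) powr \<delta> + 1)"
      using p by (simp add: ennreal_mult)
    also have "\<dots> \<le> ennreal (C + real k)"
    proof (rule ennreal_leI)
      have "real ?U powr \<delta> \<le> real (b + k) powr \<delta>"
        using \<delta> by (intro powr_mono2) (auto simp: x)
      also have "\<dots> \<le> real b powr \<delta> + real k" by (rule nat_powr_add_le[OF \<delta>])
      finally have "p * (p powr \<delta> * real ?U powr \<delta>) \<le> p * (p powr \<delta> * (real b powr \<delta> + real k))"
        using p by (intro mult_left_mono) auto
      moreover have "p * p powr \<delta> * real k \<le> 1 * 1 * real k"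
        using p lam by (intro mult_right_mono mult_mono) auto
      ultimately show "p * (real ?U * p) powr \<delta> + 1 \<le> C + real k"
        using p by (simp add: C_def powr_mult algebra_simps)
    qed
    finally show ?thesis using C by simp
  qed
  have "(\<integral>\<^sup>+y. ennreal (lyapunov p \<delta> y) \<partial>measure_pmf (sq_pmf s q p dem x))
      \<le> (\<integral>\<^sup>+k. ennreal C + ennreal (real k) \<partial>measure_pmf dem)"
    unfolding sq_pmf_def nn_integral_bind_pmf nn_integral_map_pmf by (intro nn_integral_mono step)
  also have "\<dots> = ennreal C + ennreal d" by (simp add: nn_integral_add mean)
  also have "\<dots> = ennreal (C + d)" using C d by simp
  also have "\<dots> \<le> ennreal (p powr \<delta> * lyapunov p \<delta> x + (d + 1))"
    by (intro ennreal_leI) (simp add: C_def x algebra_simps)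
  finally show ?thesis .
qed

section \<open>Steering the stock by demands 0 and 1 while all unmet customers are lost\<close>

definition impatient_step :: "nat \<Rightarrow> nat \<Rightarrow> nat \<Rightarrow> state \<Rightarrow> state" where
  "impatient_step s q k x = successor s q x k 0"

lemma pmf_impatient_step:
  assumes "0 \<le> p" "p \<le> 1"
  shows "pmf dem k * (1 - p) ^ unmet_demand s q x k \<le> pmf (sq_pmf s q p dem x) (impatient_step s q k x)"
proof -
  let ?B = "binomial_pmf (unmet_demand s q x k) p"
  have "(1 - p) ^ unmet_demand s q x k = measure ?B {0}"
    using assms by (simp add: measure_pmf_single)
  also have "\<dots> \<le> measure ?B (successor s q x k -` {successor s q x k 0})"
    by (intro measure_pmf.finite_measure_mono) auto
  also have "\<dots> = pmf (map_pmf (successor s q x k) ?B) (successor s q x k 0)"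
    by (simp add: pmf_map)
  finally have "pmf dem k * (1 - p) ^ unmet_demand s q x k
      \<le> pmf dem k * pmf (map_pmf (successor s q x k) ?B) (successor s q x k 0)"
    by (intro mult_left_mono) auto
  also have "\<dots> \<le> pmf (sq_pmf s q p dem x) (successor s q x k 0)"
    unfolding sq_pmf_def by (rule pmf_bind_ge)
  finally show ?thesis by (simp add: impatient_step_def)
qed

lemma kernel_power_Suc_first: "kernel_power K (Suc n) x = bind_pmf (K x) (kernel_power K n)"
  using kernel_power_add[of K 1 n x] by (simp add: bind_return_pmf)

text \<open>Without backorders a demand of at most 1 leaves at most one unmet customer, and losing
  that customer leads to a state without backorders again. Each period thus costs one factor
  \<open>c\<close>.\<close>

lemma pmf_impatient_path:
  assumes p: "0 \<le> p" "p \<le> 1" and c: "0 \<le> c" "c \<le> pmf dem 0 * (1 - p)" "c \<le> pmf dem 1 * (1 - p)"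
    and "set ks \<subseteq> {0, 1}" "fst (snd x) = 0"
  shows "c ^ length ks \<le> pmf (kernel_power (sq_pmf s q p dem) (length ks) x) (fold (impatient_step s q) ks x)"
  using assms(6,7)
proof (induction ks arbitrary: x)
  case (Cons k ks)
  let ?y = "impatient_step s q k x"
  obtain i Qs where x: "x = (i, 0, Qs)" using Cons.prems by (cases x) auto
  have k: "k = 0 \<or> k = 1" using Cons.prems by auto
  have "c \<le> pmf dem k * (1 - p) ^ 1" using k c by auto
  also have "\<dots> \<le> pmf dem k * (1 - p) ^ unmet_demand s q x k"
    using p k by (intro mult_left_mono power_decreasing) (auto simp: x)
  also have "\<dots> \<le> pmf (sq_pmf s q p dem x) ?y" by (rule pmf_impatient_step[OF p])
  finally have 1: "c \<le> pmf (sq_pmf s q p dem x) ?y" .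
  have 2: "c ^ length ks \<le> pmf (kernel_power (sq_pmf s q p dem) (length ks) ?y) (fold (impatient_step s q) ks ?y)"
    using Cons.prems by (intro Cons.IH) (auto simp: x Let_def impatient_step_def)
  have "c ^ length (k # ks) \<le> pmf (sq_pmf s q p dem x) ?y *
      pmf (kernel_power (sq_pmf s q p dem) (length ks) ?y) (fold (impatient_step s q) ks ?y)"
    using mult_mono[OF 1 2] c by simp
  also have "\<dots> \<le> pmf (bind_pmf (sq_pmf s q p dem x) (kernel_power (sq_pmf s q p dem) (length ks)))
      (fold (impatient_step s q) ks ?y)"
    by (rule pmf_bind_ge)
  finally show ?case by (simp add: kernel_power_Suc_first del: kernel_power.simps)
qed simp

definition flat_state :: "nat \<Rightarrow> nat \<Rightarrow> state" where
  "flat_state \<tau> i = (i, 0, replicate \<tau> 0)"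

definition reachable :: "nat \<Rightarrow> nat \<Rightarrow> state \<Rightarrow> state \<Rightarrow> bool" where
  "reachable s q x y \<longleftrightarrow> (\<exists>ks. set ks \<subseteq> {0, 1} \<and> fold (impatient_step s q) ks x = y)"

lemma reachable_refl: "reachable s q x x"
  unfolding reachable_def by (intro exI[of _ "[]"]) simp

lemma reachable_step:
  assumes "k \<le> 1" "reachable s q (impatient_step s q k x) y"
  shows "reachable s q x y"
proof -
  obtain ks where "set ks \<subseteq> {0, 1}" "fold (impatient_step s q) ks (impatient_step s q k x) = y"
    using assms(2) unfolding reachable_def by blast
  with assms(1) show ?thesis unfolding reachable_def by (intro exI[of _ "k # ks"]) auto
qed

lemma reachable_trans:
  assumes "reachable s q x y" "reachable s q y z"
  shows "reachable s q x z"
proof -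
  obtain ks ls where "set ks \<subseteq> {0, 1}" "fold (impatient_step s q) ks x = y"
    "set ls \<subseteq> {0, 1}" "fold (impatient_step s q) ls y = z"
    using assms unfolding reachable_def by blast
  then show ?thesis unfolding reachable_def by (intro exI[of _ "ks @ ls"]) auto
qed

text \<open>The trailing zeros are the empty orders placed while the pipeline shifts. No order
  becomes due on the way: an arrival keeps stock plus pipeline fixed and can only switch off the
  extra q for empty stock.\<close>

lemma reachable_deliver:
  assumes "sq_order s q (i, 0, Qs @ replicate m 0) = 0"
  shows "reachable s q (i, 0, Qs @ replicate m 0) (flat_state (length Qs + m) (i + sum_list Qs))"
  using assms
proof (induction Qs arbitrary: i m)
  case Nil
  then show ?case by (simp add: flat_state_def reachable_refl)
next
  case (Cons a Qs)
  have "sq_order s q (i + a, 0, Qs @ replicate (Suc m) 0) = 0"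
    using Cons.prems by (auto simp: of_bool_def split: if_splits)
  from Cons.IH[OF this]
  have "reachable s q (i + a, 0, Qs @ replicate (Suc m) 0) (flat_state (length (a # Qs) + m) (i + sum_list (a # Qs)))"
    by (simp add: add.assoc)
  moreover have "impatient_step s q 0 (i, 0, (a # Qs) @ replicate m 0) = (i + a, 0, Qs @ replicate (Suc m) 0)"
    using Cons.prems by (simp add: Let_def replicate_append_same impatient_step_def del: sq_order.simps)
  ultimately show ?case by (rule_tac reachable_step[of 0]) simp_all
qed

lemma reachable_flat:
  assumes "length Qs = \<tau>"
  shows "reachable s q (i, 0, Qs) (flat_state \<tau> (i + sum_list Qs + sq_order s q (i, 0, Qs)))"
proof -
  define Q where "Q = sq_order s q (i, 0, Qs)"
  define y where "y = impatient_step s q 0 (i, 0, Qs)"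
  let ?a = "hd (Qs @ [Q])" and ?Ps = "tl (Qs @ [Q])"
  have y: "y = (i + ?a, 0, ?Ps @ replicate 0 0)"
    by (simp add: y_def Q_def Let_def impatient_step_def)
  have sum: "?a + sum_list ?Ps = sum_list Qs + Q" by (rule hd_plus_sum_tl)
  \<comment> \<open>The first period has raised stock plus pipeline to the target, and the target
    does not increase when stock arrives; from here on the policy orders nothing.\<close>
  then have "sq_order s q (i + ?a, 0, ?Ps @ replicate 0 0) = 0"
    by (auto simp: Q_def of_bool_def)
  from reachable_deliver[OF this] have "reachable s q y (flat_state \<tau> (i + sum_list Qs + Q))"
    using sum assms by (simp add: y add.assoc)
  then show ?thesis unfolding y_def Q_def by (rule_tac reachable_step[of 0]) auto
qed

lemma hd_tl_replicate: "hd (replicate n 0 @ [0]) = 0" "tl (replicate n 0 @ [0]) = replicate n 0"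
  by (cases n; simp add: replicate_append_same)+

lemma reachable_descend:
  assumes "s \<le> j" "j \<le> i"
  shows "reachable s q (flat_state \<tau> i) (flat_state \<tau> j)"
  using assms(2)
proof (induction i rule: dec_induct)
  case (step i)
  have "impatient_step s q 1 (flat_state \<tau> (Suc i)) = flat_state \<tau> i"
    using step assms(1) by (simp add: flat_state_def Let_def hd_tl_replicate impatient_step_def)
  then show ?case using step by (rule_tac reachable_step[of 1]) auto
qed (rule reachable_refl)

text \<open>A state that zero demands leave unchanged. For s = 0 the empty system would order q at
  once, so the resting level is q instead of s.\<close>

definition rest_state :: "nat \<Rightarrow> nat \<Rightarrow> nat \<Rightarrow> state" where
  "rest_state \<tau> s q = flat_state \<tau> (if s = 0 then q else s)"

lemma rest_state_in_sq_states: "rest_state \<tau> s q \<in> sq_states \<tau> s q"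
  by (auto simp: rest_state_def flat_state_def sq_states_def sum_list_replicate)

lemma impatient_step_rest_state: "impatient_step s q 0 (rest_state \<tau> s q) = rest_state \<tau> s q"
  by (auto simp: rest_state_def flat_state_def Let_def sum_list_replicate hd_tl_replicate impatient_step_def)

text \<open>Draining the stock with unit demands ends at \<open>s\<close> if \<open>s > 0\<close>; if \<open>s = 0\<close> the stock is emptied
  and a full batch \<open>q\<close> is ordered.\<close>
lemma reachable_rest_state:
  assumes "x \<in> sq_states \<tau> s q" "fst (snd x) = 0"
  shows "reachable s q x (rest_state \<tau> s q)"
proof -
  obtain i Qs where x: "x = (i, 0, Qs)" using assms(2) by (cases x) auto
  with assms have len: "length Qs = \<tau>" by (simp add: sq_states_def)
  define I where "I = i + sum_list Qs + sq_order s q x"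
  have I: "s \<le> I" by (auto simp: I_def x)
  have "reachable s q x (flat_state \<tau> I)"
    using reachable_flat[OF len] by (simp only: x I_def)
  then have 1: "reachable s q x (flat_state \<tau> s)"
    by (rule reachable_trans) (rule reachable_descend[OF order_refl I])
  show ?thesis
  proof (cases "s = 0")
    case True
    have "reachable s q (flat_state \<tau> 0) (flat_state \<tau> q)"
      using reachable_flat[of "replicate \<tau> 0" \<tau> s q 0] True
      by (simp add: flat_state_def sum_list_replicate)
    moreover have "reachable s q x (flat_state \<tau> 0)" using 1 True by simp
    ultimately have "reachable s q x (flat_state \<tau> q)" by (rule reachable_trans[rotated])
    with True show ?thesis by (simp add: rest_state_def)
  qed (use 1 in \<open>simp add: rest_state_def\<close>)
qed

text \<open>Stock and outstanding orders are capped by s + q; only the backorders are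
  unbounded.\<close>

lemma finite_no_backorders: "finite {x \<in> sq_states \<tau> s q. fst (snd x) = 0}"
proof (rule finite_subset)
  show "{x \<in> sq_states \<tau> s q. fst (snd x) = 0}
      \<subseteq> {..s + q} \<times> {0} \<times> {Qs. set Qs \<subseteq> {..s + q} \<and> length Qs = \<tau>}"
  proof
    fix x assume "x \<in> {x \<in> sq_states \<tau> s q. fst (snd x) = 0}"
    then obtain i Qs where x: "x = (i, 0, Qs)" "length Qs = \<tau>" "i + sum_list Qs \<le> s + q"
      by (cases x) (auto simp: sq_states_def)
    then have "Q \<le> s + q" if "Q \<in> set Qs" for Q
      using member_le_sum_list[OF that] by linarith
    with x show "x \<in> {..s + q} \<times> {0} \<times> {Qs. set Qs \<subseteq> {..s + q} \<and> length Qs = \<tau>}"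
      by auto
  qed
qed (auto intro: finite_lists_length_eq)

lemma uniform_path_length:
  obtains N where "\<And>x. x \<in> sq_states \<tau> s q \<Longrightarrow> fst (snd x) = 0 \<Longrightarrow>
    \<exists>ks. set ks \<subseteq> {0, 1} \<and> length ks = N \<and> fold (impatient_step s q) ks x = rest_state \<tau> s q"
proof -
  let ?F = "{x \<in> sq_states \<tau> s q. fst (snd x) = 0}"
  define w where "w x = (SOME ks. set ks \<subseteq> {0, 1} \<and> fold (impatient_step s q) ks x = rest_state \<tau> s q)" for x
  have w: "set (w x) \<subseteq> {0, 1} \<and> fold (impatient_step s q) (w x) x = rest_state \<tau> s q" if "x \<in> ?F" for x
  proof -
    have "reachable s q x (rest_state \<tau> s q)" using that by (intro reachable_rest_state) auto
    then show ?thesis unfolding w_def reachable_def by (rule someI_ex)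
  qed
  \<comment> \<open>The sum dominates every single length; shorter paths are padded by waiting in
    \<open>rest_state\<close> under zero demand.\<close>
  define N where "N = (\<Sum>x\<in>?F. length (w x))"
  have rest: "fold (impatient_step s q) (replicate n 0) (rest_state \<tau> s q) = rest_state \<tau> s q" for n
    by (induction n) (simp_all add: impatient_step_rest_state)
  show ?thesis
  proof (rule that)
    fix x assume "x \<in> sq_states \<tau> s q" "fst (snd x) = 0"
    then have x: "x \<in> ?F" by simp
    then have "length (w x) \<le> N"
      unfolding N_def using finite_no_backorders by (intro member_le_sum) auto
    then show "\<exists>ks. set ks \<subseteq> {0, 1} \<and> length ks = N \<and> fold (impatient_step s q) ks x = rest_state \<tau> s q"
      using w[OF x] rest by (intro exI[of _ "w x @ replicate (N - length (w x)) 0"]) (simp add: set_replicate_conv_if)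
  qed
qed

text \<open>For p > 0 the hypothesis bounds b. For p = 0 it leaves b free, but then every power is
  1.\<close>

lemma patience_bound:
  fixes p \<delta> R :: real
  assumes "0 \<le> p" "p < 1" "0 < \<delta>"
  obtains \<eta> where "0 < \<eta>" "\<And>b. p * real b powr \<delta> \<le> R \<Longrightarrow> \<eta> \<le> (1 - p) ^ b"
proof (cases "p = 0")
  case True
  then show ?thesis using that[of 1] by simp
next
  case False
  define N where "N = nat \<lceil>(R / p) powr (1 / \<delta>)\<rceil>"
  show ?thesis
  proof (rule that[of "(1 - p) ^ N"])
    fix b assume "p * real b powr \<delta> \<le> R"
    then have "real b powr \<delta> \<le> R / p" using assms False by (simp add: field_simps)
    then have "(real b powr \<delta>) powr (1 / \<delta>) \<le> (R / p) powr (1 / \<delta>)"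
      using assms by (intro powr_mono2) auto
    then have "real b \<le> (R / p) powr (1 / \<delta>)"
      using assms by (simp add: powr_powr)
    then have "b \<le> N" unfolding N_def by linarith
    then show "(1 - p) ^ N \<le> (1 - p) ^ b"
      using assms by (intro power_decreasing) auto
  qed (use assms in \<open>simp_all add: power_le_one\<close>)
qed

text \<open>One period with zero demand in which all unmet customers leave removes the backorders at
  cost \<open>\<alpha>\<^sub>0 * \<eta>\<close>; then \<open>uniform_path_length\<close> applies.
  \<open>N\<close> and \<open>eps\<close> are chosen before \<open>dem\<close>.\<close>

lemma sq_pmf_minorization:
  fixes p \<delta> R \<alpha>\<^sub>0 \<alpha>\<^sub>1 :: real
  assumes \<alpha>: "0 < \<alpha>\<^sub>0" "0 < \<alpha>\<^sub>1" and p: "0 \<le> p" "p < 1" and \<delta>: "0 < \<delta>"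
  obtains N eps where "0 < N" "0 < eps"
    "\<And>dem x. pmf dem 0 = \<alpha>\<^sub>0 \<Longrightarrow> pmf dem 1 = \<alpha>\<^sub>1 \<Longrightarrow> x \<in> sq_states \<tau> s q \<Longrightarrow> lyapunov p \<delta> x \<le> R \<Longrightarrow>
      eps \<le> pmf (kernel_power (sq_pmf s q p dem) N x) (rest_state \<tau> s q)"
proof -
  obtain N where N: "\<And>x. x \<in> sq_states \<tau> s q \<Longrightarrow> fst (snd x) = 0 \<Longrightarrow>
    \<exists>ks. set ks \<subseteq> {0, 1} \<and> length ks = N \<and> fold (impatient_step s q) ks x = rest_state \<tau> s q"
    using uniform_path_length[of \<tau> s q] by blast
  obtain \<eta> where \<eta>: "0 < \<eta>" "\<And>b. p * real b powr \<delta> \<le> R \<Longrightarrow> \<eta> \<le> (1 - p) ^ b"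
    using patience_bound[OF p \<delta>, of R] by metis
  define c where "c = min \<alpha>\<^sub>0 \<alpha>\<^sub>1 * (1 - p)"
  have c: "0 < c" using \<alpha> p by (auto simp: c_def)
  show ?thesis
  proof (rule that[of "Suc N" "\<alpha>\<^sub>0 * \<eta> * c ^ N"])
    fix dem :: "nat pmf" and x
    assume dem: "pmf dem 0 = \<alpha>\<^sub>0" "pmf dem 1 = \<alpha>\<^sub>1" and x: "x \<in> sq_states \<tau> s q" "lyapunov p \<delta> x \<le> R"
    let ?K = "sq_pmf s q p dem" and ?y = "impatient_step s q 0 x" and ?z = "rest_state \<tau> s q"
    obtain i b Qs where xs: "x = (i, b, Qs)" by (cases x)
    have y: "?y \<in> sq_states \<tau> s q" "fst (snd ?y) = 0"
      using successor_in_sq_states[OF x(1), of 0 0] by (simp_all add: xs Let_def impatient_step_def)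
    then obtain ks where ks: "set ks \<subseteq> {0, 1}" "length ks = N" "fold (impatient_step s q) ks ?y = ?z"
      using N by blast
    have "c \<le> pmf dem 0 * (1 - p)" "c \<le> pmf dem 1 * (1 - p)"
      unfolding c_def dem using p by (auto intro: mult_right_mono)
    then have 2: "c ^ N \<le> pmf (kernel_power ?K N ?y) ?z"
      using pmf_impatient_path[of p c dem ks ?y s q] ks y p c by simp
    have "\<eta> \<le> (1 - p) ^ b" using x(2) by (intro \<eta>) (simp add: xs)
    also have "\<dots> \<le> (1 - p) ^ unmet_demand s q x 0"
      using p by (intro power_decreasing) (auto simp: xs)
    finally have "\<alpha>\<^sub>0 * \<eta> \<le> \<alpha>\<^sub>0 * (1 - p) ^ unmet_demand s q x 0"
      using \<alpha> by (intro mult_left_mono) auto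
    also have "\<dots> \<le> pmf (?K x) ?y"
      using pmf_impatient_step[of p dem 0 s q x] p dem by simp
    finally have "\<alpha>\<^sub>0 * \<eta> * c ^ N \<le> pmf (?K x) ?y * pmf (kernel_power ?K N ?y) ?z"
      using 2 c by (intro mult_mono) auto
    also have "\<dots> \<le> pmf (kernel_power ?K (Suc N) x) ?z"
      unfolding kernel_power_Suc_first by (rule pmf_bind_ge)
    finally show "\<alpha>\<^sub>0 * \<eta> * c ^ N \<le> pmf (kernel_power ?K (Suc N) x) ?z" .
  qed (use \<alpha> \<eta> c in auto)
qed

section \<open>The Markov property\<close>

lemma (in prob_space) rv_event:
  assumes "T \<in> M \<rightarrow>\<^sub>M count_space UNIV"
  shows "{\<omega> \<in> space M. T \<omega> = t} \<in> events"
proof -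
  have "{\<omega> \<in> space M. T \<omega> = t} = T -` {t} \<inter> space M" by auto
  then show ?thesis using measurable_sets[OF assms, of "{t}"] by simp
qed

lemma (in prob_space) prob_bind_pmf:
  fixes T :: "'a \<Rightarrow> 't :: countable"
  assumes T: "T \<in> M \<rightarrow>\<^sub>M count_space UNIV" and E: "{\<omega> \<in> space M. P \<omega>} \<in> events"
    and joint: "\<And>t. prob {\<omega> \<in> space M. T \<omega> = t \<and> P \<omega>} = pmf \<mu> t * pmf (k t) y"
  shows "prob {\<omega> \<in> space M. P \<omega>} = pmf (bind_pmf \<mu> k) y"
proof -
  have sets: "{\<omega> \<in> space M. T \<omega> = t \<and> P \<omega>} \<in> events" for t
  proof -
    have "{\<omega> \<in> space M. T \<omega> = t \<and> P \<omega>} = (T -` {t} \<inter> space M) \<inter> {\<omega> \<in> space M. P \<omega>}" by auto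
    then show ?thesis using measurable_sets[OF T, of "{t}"] E by simp
  qed
  have "emeasure M {\<omega> \<in> space M. P \<omega>} = emeasure M (\<Union>t. {\<omega> \<in> space M. T \<omega> = t \<and> P \<omega>})"
    by (intro arg_cong[where f="emeasure M"]) auto
  also have "\<dots> = (\<integral>\<^sup>+t. emeasure M {\<omega> \<in> space M. T \<omega> = t \<and> P \<omega>} \<partial>count_space UNIV)"
    using sets by (intro emeasure_UN_countable) (auto simp: disjoint_family_on_def)
  also have "\<dots> = (\<integral>\<^sup>+t. ennreal (pmf \<mu> t) * ennreal (pmf (k t) y) \<partial>count_space UNIV)"
    by (simp add: emeasure_eq_measure joint ennreal_mult)
  also have "\<dots> = ennreal (pmf (bind_pmf \<mu> k) y)"
    by (simp add: ennreal_pmf_bind nn_integral_measure_pmf)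
  finally show ?thesis by (simp add: emeasure_eq_measure)
qed

lemma (in prob_space) distr_eq_measure_pmf:
  fixes T :: "'a \<Rightarrow> 't :: countable"
  assumes T: "T \<in> M \<rightarrow>\<^sub>M count_space UNIV" and eq: "\<And>t. prob {\<omega> \<in> space M. T \<omega> = t} = pmf \<mu> t"
  shows "distr M (count_space UNIV) T = measure_pmf \<mu>"
proof (rule measure_eqI_countable[where A=UNIV])
  fix t
  have "T -` {t} \<inter> space M = {\<omega> \<in> space M. T \<omega> = t}" by auto
  then show "emeasure (distr M (count_space UNIV) T) {t} = emeasure (measure_pmf \<mu>) {t}"
    using T eq[of t] by (simp add: emeasure_distr emeasure_eq_measure emeasure_pmf_single)
qed auto

lemma (in prob_space) pmf_of_countable_rv:
  fixes T :: "'a \<Rightarrow> 't :: countable"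
  assumes T: "T \<in> M \<rightarrow>\<^sub>M count_space UNIV"
  obtains \<mu> where "distr M (count_space UNIV) T = measure_pmf \<mu>"
    "\<And>t. pmf \<mu> t = prob {\<omega> \<in> space M. T \<omega> = t}"
proof -
  let ?f = "\<lambda>t. prob {\<omega> \<in> space M. T \<omega> = t}"
  have "(\<integral>\<^sup>+t. ennreal (?f t) \<partial>count_space UNIV) = emeasure M (\<Union>t. {\<omega> \<in> space M. T \<omega> = t})"
    unfolding emeasure_eq_measure[symmetric] using rv_event[OF T]
    by (intro emeasure_UN_countable[symmetric]) (auto simp: disjoint_family_on_def)
  also have "(\<Union>t. {\<omega> \<in> space M. T \<omega> = t}) = space M" by auto
  finally have eq: "pmf (embed_pmf ?f) t = ?f t" for t
    by (intro pmf_embed_pmf) (auto simp: emeasure_space_1)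
  show ?thesis
  proof (rule that)
    show "distr M (count_space UNIV) T = measure_pmf (embed_pmf ?f)"
      by (rule distr_eq_measure_pmf[OF T]) (rule eq[symmetric])
    show "pmf (embed_pmf ?f) t = ?f t" for t by (rule eq)
  qed
qed

lemma measurable_sum_count_space:
  fixes X :: "nat \<Rightarrow> 'a \<Rightarrow> nat"
  assumes "\<And>l. 1 \<le> l \<Longrightarrow> l \<le> n \<Longrightarrow> X l \<in> N \<rightarrow>\<^sub>M count_space UNIV"
  shows "(\<lambda>\<omega>. \<Sum>l=1..n. X l \<omega>) \<in> N \<rightarrow>\<^sub>M count_space UNIV"
  using assms
proof (induction n)
  case (Suc n)
  have S: "(\<lambda>\<omega>. \<Sum>l=1..n. X l \<omega>) \<in> N \<rightarrow>\<^sub>M count_space UNIV" using Suc by simp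
  have "(\<lambda>\<omega>. a + X (Suc n) \<omega>) \<in> N \<rightarrow>\<^sub>M count_space UNIV" for a
    using Suc.prems[of "Suc n"] by (intro measurable_compose[where f="X (Suc n)" and g="\<lambda>b. a + b"]) auto
  from measurable_compose_countable'[OF this S]
  have "(\<lambda>\<omega>. (\<Sum>l=1..n. X l \<omega>) + X (Suc n) \<omega>) \<in> N \<rightarrow>\<^sub>M count_space UNIV" by simp
  then show ?case by simp
qed simp

text \<open>The measurable space is arbitrary because the lemma serves both the sample space and the
  product spaces on which the chain is replayed from coordinates. States and demands are countable,
  so it is enough to treat fixed values of both.\<close>

lemma measurable_sq_chain:
  assumes D: "\<And>j. 1 \<le> j \<Longrightarrow> j < i \<Longrightarrow> D j \<in> N \<rightarrow>\<^sub>M count_space UNIV"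
    and \<xi>: "\<And>j l. 1 \<le> j \<Longrightarrow> j < i \<Longrightarrow> 1 \<le> l \<Longrightarrow> \<xi> j l \<in> N \<rightarrow>\<^sub>M count_space UNIV"
  shows "sq_chain s q D \<xi> x i \<in> N \<rightarrow>\<^sub>M count_space UNIV"
  using assms
proof (induction i)
  case 0
  have "sq_chain s q D \<xi> x 0 = (\<lambda>_. x)" by (simp add: fun_eq_iff)
  then show ?case by simp
next
  case (Suc i)
  show ?case
  proof (cases "i = 0")
    case False
    let ?X = "sq_chain s q D \<xi> x i"
    have X: "?X \<in> N \<rightarrow>\<^sub>M count_space UNIV" using Suc by simp
    have Di: "D i \<in> N \<rightarrow>\<^sub>M count_space UNIV" using False Suc.prems(1) by simp
    have "(\<lambda>\<omega>. successor s q y k (\<Sum>l=1..unmet_demand s q y k. \<xi> i l \<omega>)) \<in> N \<rightarrow>\<^sub>M count_space UNIV" for y k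
      using False Suc.prems(2) by (intro measurable_compose[OF measurable_sum_count_space]) auto
    then have "(\<lambda>\<omega>. successor s q y (D i \<omega>) (\<Sum>l=1..unmet_demand s q y (D i \<omega>). \<xi> i l \<omega>)) \<in> N \<rightarrow>\<^sub>M count_space UNIV" for y
      by (rule measurable_compose_countable'[OF _ Di]) auto
    then have "(\<lambda>\<omega>. successor s q (?X \<omega>) (D i \<omega>) (\<Sum>l=1..unmet_demand s q (?X \<omega>) (D i \<omega>). \<xi> i l \<omega>)) \<in> N \<rightarrow>\<^sub>M count_space UNIV"
      by (rule measurable_compose_countable'[OF _ X]) auto
    moreover have "sq_chain s q D \<xi> x (Suc i)
        = (\<lambda>\<omega>. successor s q (?X \<omega>) (D i \<omega>) (\<Sum>l=1..unmet_demand s q (?X \<omega>) (D i \<omega>). \<xi> i l \<omega>))"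
      using False by (simp add: fun_eq_iff next_state_successor)
    ultimately show ?thesis by simp
  next
    case True
    then have "sq_chain s q D \<xi> x (Suc i) = (\<lambda>_. x)" by (simp add: fun_eq_iff)
    then show ?thesis by simp
  qed
qed

text \<open>The state at time i reads only primitives of earlier periods, here even across different
  sample spaces.\<close>

lemma sq_chain_cong:
  assumes "\<And>j. 1 \<le> j \<Longrightarrow> j < i \<Longrightarrow> D j \<omega> = D' j \<omega>'"
    and "\<And>j l. 1 \<le> j \<Longrightarrow> j < i \<Longrightarrow> 1 \<le> l \<Longrightarrow> \<xi> j l \<omega> = \<xi>' j l \<omega>'"
  shows "sq_chain s q D \<xi> x i \<omega> = sq_chain s q D' \<xi>' x i \<omega>'"
  using assms
proof (induction i)
  case (Suc i)
  then have "sq_chain s q D \<xi> x i \<omega> = sq_chain s q D' \<xi>' x i \<omega>'" by simp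
  moreover have "D i \<omega> = D' i \<omega>'" "\<And>l. 1 \<le> l \<Longrightarrow> \<xi> i l \<omega> = \<xi>' i l \<omega>'" if "i \<noteq> 0"
    using that Suc.prems by simp_all
  ultimately show ?case by (simp add: next_state_successor)
qed simp

section \<open>Independence within one period and the resulting transition law\<close>

context partial_backorder_system
begin

lemma measurable_demand: "1 \<le> i \<Longrightarrow> D i \<in> M \<rightarrow>\<^sub>M count_space UNIV"
proof -
  assume "1 \<le> i"
  then have "Inl i \<in> {1..} <+> {1..} \<times> {1..}" by auto
  with indep_primitives show ?thesis unfolding indep_vars_def by force
qed

lemma measurable_patience: "1 \<le> i \<Longrightarrow> 1 \<le> l \<Longrightarrow> \<xi> i l \<in> M \<rightarrow>\<^sub>M count_space UNIV"
proof -
  assume "1 \<le> i" "1 \<le> l"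
  then have "Inr (i, l) \<in> {1..} <+> {1..} \<times> {1..}" by auto
  with indep_primitives show ?thesis unfolding indep_vars_def by force
qed

text \<open>Events determined by disjoint blocks of one jointly independent family are independent;
  \<open>P\<close> describes the event \<open>E\<close> through the coordinates of its
  block.\<close>

lemma prob_blocks:
  fixes B :: "'j \<Rightarrow> (nat + nat \<times> nat) set" and P :: "'j \<Rightarrow> (nat + nat \<times> nat \<Rightarrow> nat) \<Rightarrow> bool"
  assumes L: "finite L" "L \<noteq> {}"
    and B: "\<And>j. j \<in> L \<Longrightarrow> B j \<subseteq> {1..} <+> {1..} \<times> {1..}" "disjoint_family_on B L"
    and P: "\<And>j. j \<in> L \<Longrightarrow> P j \<in> PiM (B j) (\<lambda>_. count_space UNIV) \<rightarrow>\<^sub>M count_space UNIV"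
    and eq: "\<And>j \<omega>. j \<in> L \<Longrightarrow> \<omega> \<in> space M \<Longrightarrow>
      E j \<omega> \<longleftrightarrow> P j (restrict (\<lambda>k. case_sum D (\<lambda>(i, l). \<xi> i l) k \<omega>) (B j))"
  shows "prob {\<omega> \<in> space M. \<forall>j\<in>L. E j \<omega>} = (\<Prod>j\<in>L. prob {\<omega> \<in> space M. E j \<omega>})"
proof -
  let ?R = "\<lambda>j \<omega>. restrict (\<lambda>k. case_sum D (\<lambda>(i, l). \<xi> i l) k \<omega>) (B j)"
  have "indep_vars (\<lambda>j. PiM (B j) (\<lambda>_. count_space UNIV)) ?R L"
    using indep_primitives B by (rule indep_vars_restrict)
  then have "indep_vars (\<lambda>_. count_space UNIV) (\<lambda>j \<omega>. P j (?R j \<omega>)) L"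
    using P by (rule indep_vars_compose2)
  from indep_varsD_finite[OF this L(2,1), of "\<lambda>_. {True}"]
  have "prob (\<Inter>j\<in>L. (\<lambda>\<omega>. P j (?R j \<omega>)) -` {True} \<inter> space M)
      = (\<Prod>j\<in>L. prob ((\<lambda>\<omega>. P j (?R j \<omega>)) -` {True} \<inter> space M))" by simp
  also have "(\<Inter>j\<in>L. (\<lambda>\<omega>. P j (?R j \<omega>)) -` {True} \<inter> space M) = {\<omega> \<in> space M. \<forall>j\<in>L. E j \<omega>}"
    using L(2) eq by auto
  also have "(\<Prod>j\<in>L. prob ((\<lambda>\<omega>. P j (?R j \<omega>)) -` {True} \<inter> space M)) = (\<Prod>j\<in>L. prob {\<omega> \<in> space M. E j \<omega>})"
    using eq by (intro prod.cong refl arg_cong[where f=prob]) auto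
  finally show ?thesis .
qed

lemma distr_patience_sum:
  assumes i: "1 \<le> i"
  shows "distr M (count_space UNIV) (\<lambda>\<omega>. \<Sum>l=1..n. \<xi> i l \<omega>) = measure_pmf (binomial_pmf n p)"
proof (induction n)
  case 0
  have "distr M (count_space UNIV) (\<lambda>\<omega>. 0 :: nat) = measure_pmf (return_pmf 0)"
    by (intro distr_eq_measure_pmf) (auto simp: prob_space indicator_def)
  then show ?case using p_nonneg p_le_1 by (simp add: binomial_pmf_0)
next
  case (Suc n)
  let ?S = "\<lambda>\<omega>. \<Sum>l=1..n. \<xi> i l \<omega>" and ?b = "map_pmf of_bool (bernoulli_pmf p) :: nat pmf"
  have S: "?S \<in> M \<rightarrow>\<^sub>M count_space UNIV" "(\<lambda>\<omega>. \<Sum>l=1..Suc n. \<xi> i l \<omega>) \<in> M \<rightarrow>\<^sub>M count_space UNIV"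
    by (intro measurable_sum_count_space measurable_patience i; assumption)+
  have \<xi>: "\<xi> i (Suc n) \<in> M \<rightarrow>\<^sub>M count_space UNIV" using i by (intro measurable_patience) auto
  have "prob {\<omega> \<in> space M. (\<Sum>l=1..Suc n. \<xi> i l \<omega>) = m} = pmf (bind_pmf ?b (\<lambda>e. map_pmf ((+) e) (binomial_pmf n p))) m" for m
  proof (rule prob_bind_pmf[OF \<xi>])
    show "{\<omega> \<in> space M. (\<Sum>l=1..Suc n. \<xi> i l \<omega>) = m} \<in> events"
      by (rule rv_event[OF S(2)])
    fix e
    \<comment> \<open>Two blocks indexed by \<open>bool\<close>: \<open>True\<close> is the last
      customer, \<open>False\<close> the first \<open>n\<close>.\<close>
    let ?B = "\<lambda>b. if b then {Inr (i, Suc n)} else Inr ` ({i} \<times> {1..n}) :: (nat + nat \<times> nat) set"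
    let ?P = "\<lambda>b w. if b then w (Inr (i, Suc n)) = e else e + (\<Sum>l=1..n. w (Inr (i, l))) = m"
    let ?E = "\<lambda>b \<omega>. if b then \<xi> i (Suc n) \<omega> = e else e + ?S \<omega> = m"
    have meas: "(\<lambda>w :: nat + nat \<times> nat \<Rightarrow> nat. \<Sum>l=1..n. w (Inr (i, l))) \<in> PiM (Inr ` ({i} \<times> {1..n})) (\<lambda>_. count_space UNIV) \<rightarrow>\<^sub>M count_space UNIV"
      by (intro measurable_sum_count_space measurable_component_singleton) auto
    have meas': "(\<lambda>w :: nat + nat \<times> nat \<Rightarrow> nat. w (Inr (i, Suc n)))
        \<in> PiM {Inr (i, Suc n)} (\<lambda>_. count_space UNIV) \<rightarrow>\<^sub>M count_space UNIV"
      by (intro measurable_component_singleton) auto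
    have "prob {\<omega> \<in> space M. \<forall>b\<in>UNIV. ?E b \<omega>} = (\<Prod>b\<in>UNIV. prob {\<omega> \<in> space M. ?E b \<omega>})"
    proof (rule prob_blocks[where B="?B" and P="?P"])
      show "?B b \<subseteq> {1..} <+> {1..} \<times> {1..}" for b using i by auto
      show "disjoint_family_on ?B UNIV" by (auto simp: disjoint_family_on_def)
      show "?P b \<in> PiM (?B b) (\<lambda>_. count_space UNIV) \<rightarrow>\<^sub>M count_space UNIV" for b
        using measurable_compose[OF meas, of "\<lambda>a. e + a = m" "count_space UNIV"]
          measurable_compose[OF meas', of "\<lambda>a. a = e" "count_space UNIV"]
        by (cases b) auto
    qed auto
    also have "{\<omega> \<in> space M. \<forall>b\<in>UNIV. ?E b \<omega>} = {\<omega> \<in> space M. \<xi> i (Suc n) \<omega> = e \<and> (\<Sum>l=1..Suc n. \<xi> i l \<omega>) = m}"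
      by (auto simp: UNIV_bool add.commute)
    also have "(\<Prod>b\<in>UNIV. prob {\<omega> \<in> space M. ?E b \<omega>})
        = prob {\<omega> \<in> space M. \<xi> i (Suc n) \<omega> = e} * prob {\<omega> \<in> space M. e + ?S \<omega> = m}"
      by (simp add: UNIV_bool mult.commute)
    also have "{\<omega> \<in> space M. \<xi> i (Suc n) \<omega> = e} = \<xi> i (Suc n) -` {e} \<inter> space M" by auto
    also have "prob \<dots> = pmf ?b e"
      using measure_distr[OF \<xi>, of "{e}"] patience_bernoulli[of i "Suc n"] i by (simp add: measure_pmf_single)
    also have "{\<omega> \<in> space M. e + ?S \<omega> = m} = ?S -` ((+) e -` {m}) \<inter> space M" by auto
    also have "prob \<dots> = pmf (map_pmf ((+) e) (binomial_pmf n p)) m"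
      using measure_distr[OF S(1), of "(+) e -` {m}"] Suc.IH by (simp add: pmf_map)
    finally show "prob {\<omega> \<in> space M. \<xi> i (Suc n) \<omega> = e \<and> (\<Sum>l=1..Suc n. \<xi> i l \<omega>) = m}
        = pmf ?b e * pmf (map_pmf ((+) e) (binomial_pmf n p)) m" .
  qed
  moreover have "bind_pmf ?b (\<lambda>e. map_pmf ((+) e) (binomial_pmf n p)) = binomial_pmf (Suc n) p"
    using p_nonneg p_le_1 by (simp add: binomial_pmf_Suc map_pmf_def bind_assoc_pmf bind_return_pmf of_bool_def)
  ultimately show ?case by (intro distr_eq_measure_pmf S) simp
qed

text \<open>Three disjoint blocks: all primitives of earlier periods, the present demand, and the
  first \<open>n\<close> present customers. Here \<open>n\<close> is a constant; the random number
  of unmet customers is handled by fixing state and demand.\<close>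

lemma prob_chain_demand_patience:
  assumes i: "1 \<le> i"
  shows "prob {\<omega> \<in> space M. sq_chain s q D \<xi> x i \<omega> = y \<and> D i \<omega> = k \<and> (\<Sum>l=1..n. \<xi> i l \<omega>) \<in> A}
    = prob {\<omega> \<in> space M. sq_chain s q D \<xi> x i \<omega> = y} * prob {\<omega> \<in> space M. D i \<omega> = k}
      * measure (binomial_pmf n p) A"
proof -
  let ?B = "\<lambda>j :: nat. if j = 0 then {1..<i} <+> {1..<i} \<times> {1..} else if j = 1 then {Inl i}
    else Inr ` ({i} \<times> {1..n}) :: (nat + nat \<times> nat) set"
  let ?D = "\<lambda>j w. w (Inl j) :: nat" and ?\<xi> = "\<lambda>j l w. w (Inr (j, l)) :: nat"
  let ?P = "\<lambda>j w. if j = 0 then sq_chain s q ?D ?\<xi> x i w = y else if j = 1 then w (Inl i) = k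
    else (\<Sum>l=1..n. w (Inr (i, l))) \<in> A"
  let ?E = "\<lambda>j \<omega>. if j = 0 then sq_chain s q D \<xi> x i \<omega> = y else if j = 1 then D i \<omega> = k
    else (\<Sum>l=1..n. \<xi> i l \<omega>) \<in> A"
  have m0: "sq_chain s q ?D ?\<xi> x i \<in> PiM ({1..<i} <+> {1..<i} \<times> {1..}) (\<lambda>_. count_space UNIV) \<rightarrow>\<^sub>M count_space UNIV"
    by (intro measurable_sq_chain measurable_component_singleton) auto
  have m1: "(\<lambda>w :: nat + nat \<times> nat \<Rightarrow> nat. w (Inl i)) \<in> PiM {Inl i} (\<lambda>_. count_space UNIV) \<rightarrow>\<^sub>M count_space UNIV"
    by (intro measurable_component_singleton) auto
  have m2: "(\<lambda>w :: nat + nat \<times> nat \<Rightarrow> nat. \<Sum>l=1..n. w (Inr (i, l))) \<in> PiM (Inr ` ({i} \<times> {1..n})) (\<lambda>_. count_space UNIV) \<rightarrow>\<^sub>M count_space UNIV"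
    by (intro measurable_sum_count_space measurable_component_singleton) auto
  have S: "(\<lambda>\<omega>. \<Sum>l=1..n. \<xi> i l \<omega>) \<in> M \<rightarrow>\<^sub>M count_space UNIV"
    by (intro measurable_sum_count_space measurable_patience i; assumption)
  have "prob {\<omega> \<in> space M. \<forall>j\<in>{0::nat,1,2}. ?E j \<omega>} = (\<Prod>j\<in>{0::nat,1,2}. prob {\<omega> \<in> space M. ?E j \<omega>})"
  proof (rule prob_blocks[where B="?B" and P="?P"])
    show "?B j \<subseteq> {1..} <+> {1..} \<times> {1..}" for j using i by auto
    show "disjoint_family_on ?B {0::nat,1,2}" by (auto simp: disjoint_family_on_def)
    show "?P j \<in> PiM (?B j) (\<lambda>_. count_space UNIV) \<rightarrow>\<^sub>M count_space UNIV" if "j \<in> {0::nat,1,2}" for j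
      using that measurable_compose[OF m0, of "\<lambda>a. a = y" "count_space UNIV"]
        measurable_compose[OF m1, of "\<lambda>a. a = k" "count_space UNIV"]
        measurable_compose[OF m2, of "\<lambda>a. a \<in> A" "count_space UNIV"]
      by auto
    fix j \<omega>
    assume j: "j \<in> {0::nat,1,2}"
    have "sq_chain s q D \<xi> x i \<omega> = sq_chain s q ?D ?\<xi> x i (restrict (\<lambda>k. case_sum D (\<lambda>(i, l). \<xi> i l) k \<omega>) (?B 0))"
      by (rule sq_chain_cong) auto
    with j show "?E j \<omega> \<longleftrightarrow> ?P j (restrict (\<lambda>k. case_sum D (\<lambda>(i, l). \<xi> i l) k \<omega>) (?B j))"
      by auto
  qed auto
  also have "{\<omega> \<in> space M. \<forall>j\<in>{0::nat,1,2}. ?E j \<omega>}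
      = {\<omega> \<in> space M. sq_chain s q D \<xi> x i \<omega> = y \<and> D i \<omega> = k \<and> (\<Sum>l=1..n. \<xi> i l \<omega>) \<in> A}"
    by auto
  also have "(\<Prod>j\<in>{0::nat,1,2}. prob {\<omega> \<in> space M. ?E j \<omega>})
      = prob {\<omega> \<in> space M. sq_chain s q D \<xi> x i \<omega> = y} * prob {\<omega> \<in> space M. D i \<omega> = k}
        * prob {\<omega> \<in> space M. (\<Sum>l=1..n. \<xi> i l \<omega>) \<in> A}"
    by simp
  also have "{\<omega> \<in> space M. (\<Sum>l=1..n. \<xi> i l \<omega>) \<in> A} = (\<lambda>\<omega>. \<Sum>l=1..n. \<xi> i l \<omega>) -` A \<inter> space M" by auto
  also have "prob \<dots> = measure (binomial_pmf n p) A"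
    using measure_distr[OF S, of A] distr_patience_sum[OF i, of n] by simp
  finally show ?thesis .
qed

text \<open>Period 1 carries the initial state, so period \<open>Suc n\<close> is \<open>n\<close>
  transitions later.\<close>

lemma sq_prob_kernel_power:
  assumes dem: "distr M (count_space UNIV) (D 1) = measure_pmf dem"
  shows "sq_prob M s q D \<xi> (Suc n) x y = pmf (kernel_power (sq_pmf s q p dem) n x) y"
proof (induction n arbitrary: y)
  case 0
  show ?case by (auto simp: sq_prob_def prob_space indicator_def)
next
  case (Suc n)
  let ?i = "Suc n" and ?K = "sq_pmf s q p dem"
  let ?X = "sq_chain s q D \<xi> x ?i" and ?Y = "sq_chain s q D \<xi> x (Suc ?i)"
  have X: "?X \<in> M \<rightarrow>\<^sub>M count_space UNIV" and Y: "?Y \<in> M \<rightarrow>\<^sub>M count_space UNIV"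
    by (intro measurable_sq_chain measurable_demand measurable_patience; simp)+
  have Y_eq: "?Y \<omega> = successor s q (?X \<omega>) (D ?i \<omega>) (\<Sum>l=1..unmet_demand s q (?X \<omega>) (D ?i \<omega>). \<xi> ?i l \<omega>)" for \<omega>
    by (subst sq_chain.simps(2)) (simp add: next_state_successor del: sq_chain.simps)
  have D: "D ?i \<in> M \<rightarrow>\<^sub>M count_space UNIV" by (intro measurable_demand) simp
  have XD: "(\<lambda>\<omega>. (?X \<omega>, D ?i \<omega>)) \<in> M \<rightarrow>\<^sub>M count_space UNIV"
  proof (rule measurable_compose_countable'[OF _ X])
    show "(\<lambda>\<omega>. (a, D ?i \<omega>)) \<in> M \<rightarrow>\<^sub>M count_space UNIV" for a
      using D by (rule measurable_compose) simp
  qed auto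
  have prob_D: "prob {\<omega> \<in> space M. D ?i \<omega> = k} = pmf dem k" for k
  proof -
    have eq: "distr M (count_space UNIV) (D ?i) = measure_pmf dem"
      by (rule trans[OF demand_identically_distributed dem]) simp
    have "{\<omega> \<in> space M. D ?i \<omega> = k} = D ?i -` {k} \<inter> space M" by auto
    also have "prob \<dots> = measure (distr M (count_space UNIV) (D ?i)) {k}"
      by (rule measure_distr[OF D, symmetric]) simp
    also have "\<dots> = pmf dem k" unfolding eq by (rule measure_pmf_single)
    finally show ?thesis .
  qed
  have "prob {\<omega> \<in> space M. ?Y \<omega> = y}
      = pmf (bind_pmf (pair_pmf (kernel_power ?K n x) dem)
          (\<lambda>u. map_pmf (successor s q (fst u) (snd u)) (binomial_pmf (unmet_demand s q (fst u) (snd u)) p))) y"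
  proof (rule prob_bind_pmf[OF XD])
    show "{\<omega> \<in> space M. ?Y \<omega> = y} \<in> events"
      by (rule rv_event[OF Y])
    fix u :: "state \<times> nat"
    obtain z k where u: "u = (z, k)" by (cases u)
    let ?U = "unmet_demand s q z k"
    \<comment> \<open>Once state and demand are fixed, the upper limit of the patience sum is the
      constant \<open>?U\<close>.\<close>
    have eq: "{\<omega> \<in> space M. (?X \<omega>, D ?i \<omega>) = u \<and> ?Y \<omega> = y}
        = {\<omega> \<in> space M. ?X \<omega> = z \<and> D ?i \<omega> = k \<and> (\<Sum>l=1..?U. \<xi> ?i l \<omega>) \<in> successor s q z k -` {y}}"
      by (auto simp: u Y_eq simp del: sq_chain.simps)
    have "1 \<le> ?i" by simp
    show "prob {\<omega> \<in> space M. (?X \<omega>, D ?i \<omega>) = u \<and> ?Y \<omega> = y}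
        = pmf (pair_pmf (kernel_power ?K n x) dem) u *
          pmf (map_pmf (successor s q (fst u) (snd u)) (binomial_pmf (unmet_demand s q (fst u) (snd u)) p)) y"
      unfolding eq prob_chain_demand_patience[OF \<open>1 \<le> ?i\<close>] Suc.IH[unfolded sq_prob_def] prob_D
      by (simp add: u pmf_pair pmf_map)
  qed
  also have "bind_pmf (pair_pmf (kernel_power ?K n x) dem)
          (\<lambda>u. map_pmf (successor s q (fst u) (snd u)) (binomial_pmf (unmet_demand s q (fst u) (snd u)) p))
      = kernel_power ?K (Suc n) x"
    by (simp add: pair_pmf_def bind_assoc_pmf bind_return_pmf sq_pmf_def[abs_def])
  finally show ?case by (simp only: sq_prob_def)
qed

lemma sq_kernel_eq:
  assumes "distr M (count_space UNIV) (D 1) = measure_pmf dem"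
  shows "sq_kernel M s q D \<xi> = sq_pmf s q p dem"
proof (intro ext pmf_eqI)
  fix x y
  have "sq_prob M s q D \<xi> 2 x = pmf (sq_pmf s q p dem x)"
    using sq_prob_kernel_power[OF assms, of s q 1 x] by (auto simp: numeral_2_eq_2 bind_return_pmf)
  then show "pmf (sq_kernel M s q D \<xi> x) y = pmf (sq_pmf s q p dem x) y"
    by (simp add: sq_kernel_def pmf_embed_pmf nn_integral_pmf)
qed

end

section \<open>Geometric ergodicity\<close>

lemma l1_infsum_le:
  fixes f :: "'a \<Rightarrow> real"
  assumes "\<And>F. finite F \<Longrightarrow> (\<Sum>y\<in>F. \<bar>f y\<bar>) \<le> c"
  shows "(\<lambda>y. \<bar>f y\<bar>) summable_on S" and "(\<Sum>\<^sub>\<infinity>y\<in>S. \<bar>f y\<bar>) \<le> c"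
proof -
  show "(\<lambda>y. \<bar>f y\<bar>) summable_on S"
    using assms
    by (intro nonneg_bounded_partial_sums_imp_summable_on[where C=c] eventually_finite_subsets_at_top_weakI) auto
  then show "(\<Sum>\<^sub>\<infinity>y\<in>S. \<bar>f y\<bar>) \<le> c"
    using assms by (intro infsum_le_finite_sums)
qed

lemma lyapunov_ge_1: "0 \<le> p \<Longrightarrow> 1 \<le> lyapunov p \<delta> x"
  by (cases x) simp

theorem proposition9:
  fixes \<tau> s q :: nat and p d \<delta> \<alpha>\<^sub>0 \<alpha>\<^sub>1 :: real
  assumes "0 < \<alpha>\<^sub>0" and "0 < \<alpha>\<^sub>1" and "0 \<le> p" and "p < 1" and "0 < \<delta>" and "\<delta> \<le> 1"
  shows "\<exists>\<beta> \<theta> \<rho> :: real. 0 < \<beta> \<and> 0 < \<theta> \<and> \<theta> < 1 \<and> \<theta> < \<rho> \<and> \<rho> < 1 \<and>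
    (\<forall>(M :: 'w measure) D \<xi>.
       partial_backorder_system M p d D \<xi> \<longrightarrow>
       measure M {\<omega> \<in> space M. D 1 \<omega> = 0} = \<alpha>\<^sub>0 \<longrightarrow>
       measure M {\<omega> \<in> space M. D 1 \<omega> = 1} = \<alpha>\<^sub>1 \<longrightarrow>
       (\<exists>\<pi> :: state pmf.
          geometrically_ergodic (sq_states \<tau> s q) (sq_kernel M s q D \<xi>) \<pi> \<and>
          (\<forall>x \<in> sq_states \<tau> s q. \<forall>i \<ge> 1.
             (\<lambda>y. \<bar>sq_prob M s q D \<xi> i x y - pmf \<pi> y\<bar>) summable_on sq_states \<tau> s q \<and>
             (\<Sum>\<^sub>\<infinity>y\<in>sq_states \<tau> s q. \<bar>sq_prob M s q D \<xi> i x y - pmf \<pi> y\<bar>)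
               \<le> lyapunov p \<delta> x * ((1 + \<beta>) * \<rho> ^ (i + 1) / (\<rho> - \<theta>)))))"
proof -
  let ?S = "sq_states \<tau> s q" and ?V = "lyapunov p \<delta>" and ?z = "rest_state \<tau> s q"
  define lam where "lam = p powr \<delta>"
  have lam: "0 \<le> lam" "lam < 1"
    using assms powr_less_mono2[of \<delta> p 1] by (simp_all add: lam_def)
  \<comment> \<open>Matches the constant d + 1 of \<open>sq_pmf_drift\<close>. The absolute value is
    taken because \<open>d\<close> is known to be nonnegative only once a system is given.\<close>
  define b where "b = (\<bar>d\<bar> + 1) / (1 - lam)"
  have b: "0 < b" "(1 - lam) * b = \<bar>d\<bar> + 1" using lam by (simp_all add: b_def)
  define R where "R = 4 * b / (1 - lam)"
  have R: "0 < R" "4 * b \<le> (1 - lam) * R" using lam b(1) by (simp_all add: R_def)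
  obtain N eps' where N: "0 < N" and eps': "0 < eps'" and minor:
    "\<And>dem x. pmf dem 0 = \<alpha>\<^sub>0 \<Longrightarrow> pmf dem 1 = \<alpha>\<^sub>1 \<Longrightarrow> x \<in> ?S \<Longrightarrow> ?V x \<le> R \<Longrightarrow>
      eps' \<le> pmf (kernel_power (sq_pmf s q p dem) N x) ?z"
    using sq_pmf_minorization[OF assms(1-5), of \<tau> s q R] by metis
  define eps where "eps = min eps' 1"
  have eps: "0 < eps" "eps \<le> 1" "eps \<le> eps'" using eps' by (auto simp: eps_def)
  obtain A r where A: "0 \<le> A" and r: "0 < r" "r < 1"
    and far: "\<And>s. R \<le> s \<Longrightarrow> A + (lam * s + 2 * b) \<le> r * (A + s)"
    and near: "\<And>s. 0 \<le> s \<Longrightarrow> A * (1 - eps * eps) + (lam * s + 2 * b) \<le> r * (A + s)"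
    using contraction_constants[OF lam less_imp_le[OF b(1)] eps(1,2) R] by metis
  \<comment> \<open>This is \<open>rate\<close> of the later locale instance, fixed here because the
    constants precede the system.\<close>
  define \<rho> where "\<rho> = root N r"
  have \<rho>: "0 < \<rho>" "\<rho> < 1" using r N by (auto simp: \<rho>_def)
  \<comment> \<open>The factor 2 covers \<open>?V x + ?V ?z\<close>: the rest state has no
    backorders, so \<open>?V ?z\<close> = 1, which is at most \<open>?V x\<close>.\<close>
  define C where "C = 2 * ((A + 2 * b + 1) / r)"
  have C: "0 < C" using A b r by (simp add: C_def)
  \<comment> \<open>Dividing by \<rho> pays for the shift from \<open>n\<close> transitions to
    period \<open>i = Suc n\<close>.\<close>
  define \<beta> where "\<beta> = C / \<rho>"
  have \<beta>: "0 < \<beta>" using C \<rho> by (simp add: \<beta>_def)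
  show ?thesis
  proof (rule exI[of _ \<beta>], rule exI[of _ "\<rho> / 2"], rule exI[of _ \<rho>], intro conjI allI impI)
    fix M :: "'w measure" and D \<xi>
    assume sys: "partial_backorder_system M p d D \<xi>"
      and \<alpha>: "measure M {\<omega> \<in> space M. D 1 \<omega> = 0} = \<alpha>\<^sub>0" "measure M {\<omega> \<in> space M. D 1 \<omega> = 1} = \<alpha>\<^sub>1"
    interpret partial_backorder_system M p d D \<xi> by (rule sys)
    have D1: "D 1 \<in> M \<rightarrow>\<^sub>M count_space UNIV" by (rule measurable_demand) simp
    obtain dem where dem: "distr M (count_space UNIV) (D 1) = measure_pmf dem"
      and pmf_dem: "\<And>k. pmf dem k = prob {\<omega> \<in> space M. D 1 \<omega> = k}"
      using pmf_of_countable_rv[OF D1] by metis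
    have d: "0 \<le> d" unfolding demand_mean[symmetric] by (rule integral_nonneg_AE) simp
    have "(\<integral>\<^sup>+k. ennreal (real k) \<partial>measure_pmf dem) = (\<integral>\<^sup>+\<omega>. ennreal (real (D 1 \<omega>)) \<partial>M)"
      unfolding dem[symmetric] by (rule nn_integral_distr[OF D1]) simp
    also have "\<dots> = ennreal d"
      using nn_integral_eq_integral[OF demand_integrable] demand_mean by simp
    finally have mean: "(\<integral>\<^sup>+k. ennreal (real k) \<partial>measure_pmf dem) = ennreal d" .
    let ?K = "sq_pmf s q p dem"
    interpret harris_kernel ?K ?S ?V lam b R eps N ?z A r
    proof
      fix x assume x: "x \<in> ?S"
      show "set_pmf (?K x) \<subseteq> ?S" using sq_pmf_closed assms x by simp
      show "1 \<le> ?V x" using assms by (intro lyapunov_ge_1)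
      show "(\<integral>\<^sup>+y. ennreal (?V y) \<partial>measure_pmf (?K x)) \<le> ennreal (lam * ?V x + (1 - lam) * b)"
        using sq_pmf_drift[OF assms(3-6) d mean, of s q x] d by (simp add: b(2) lam_def[symmetric])
      show "eps \<le> pmf (kernel_power ?K N x) ?z" if "?V x \<le> R"
        using eps(3) by (rule order_trans) (rule minor, use pmf_dem \<alpha> x that in simp_all)
    qed (use lam b eps N A r far near in auto)
    have rate_eq: "rate = \<rho>" by (simp add: rate_def \<rho>_def)
    obtain \<pi> where \<pi>: "set_pmf \<pi> \<subseteq> ?S" "bind_pmf \<pi> ?K = \<pi>"
      and dist: "\<forall>x\<in>?S. \<forall>n F. finite F \<longrightarrow>
        (\<Sum>w\<in>F. \<bar>pmf (kernel_power ?K n x) w - pmf \<pi> w\<bar>) \<le> (A + 2 * b + 1) / r * (?V x + ?V ?z) * \<rho> ^ n"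
      by (rule ergodic[OF rest_state_in_sq_states, unfolded rate_eq])
    have bound: "(\<Sum>w\<in>F. \<bar>pmf (kernel_power ?K n x) w - pmf \<pi> w\<bar>) \<le> C * ?V x * \<rho> ^ n"
      if "x \<in> ?S" "finite F" for x n F
    proof -
      have "?V ?z = 1" by (simp add: rest_state_def flat_state_def)
      then have "?V x + ?V ?z \<le> 2 * ?V x" using lyapunov_ge_1[OF assms(3), of \<delta> x] by simp
      then have "(A + 2 * b + 1) / r * (?V x + ?V ?z) * \<rho> ^ n \<le> (A + 2 * b + 1) / r * (2 * ?V x) * \<rho> ^ n"
        using A b r \<rho> by (intro mult_right_mono mult_left_mono) auto
      moreover have "(\<Sum>w\<in>F. \<bar>pmf (kernel_power ?K n x) w - pmf \<pi> w\<bar>)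
          \<le> (A + 2 * b + 1) / r * (?V x + ?V ?z) * \<rho> ^ n"
        using dist that by blast
      moreover have "(A + 2 * b + 1) / r * (2 * ?V x) * \<rho> ^ n = C * ?V x * \<rho> ^ n"
        unfolding C_def by simp
      ultimately show ?thesis by linarith
    qed
    show "\<exists>\<pi>. geometrically_ergodic ?S (sq_kernel M s q D \<xi>) \<pi> \<and>
      (\<forall>x\<in>?S. \<forall>i\<ge>1. (\<lambda>y. \<bar>sq_prob M s q D \<xi> i x y - pmf \<pi> y\<bar>) summable_on ?S \<and>
        (\<Sum>\<^sub>\<infinity>y\<in>?S. \<bar>sq_prob M s q D \<xi> i x y - pmf \<pi> y\<bar>)
          \<le> ?V x * ((1 + \<beta>) * \<rho> ^ (i + 1) / (\<rho> - \<rho> / 2)))"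
    proof (rule exI[of _ \<pi>], intro conjI ballI allI impI)
      have "\<exists>C. \<forall>n. (\<Sum>\<^sub>\<infinity>y\<in>?S. \<bar>pmf (kernel_power ?K n x) y - pmf \<pi> y\<bar>) \<le> C * \<rho> ^ n"
        if "x \<in> ?S" for x
        using l1_infsum_le(2)[OF bound[OF that]] by blast
      then show "geometrically_ergodic ?S (sq_kernel M s q D \<xi>) \<pi>"
        unfolding geometrically_ergodic_def sq_kernel_eq[OF dem] using closed \<pi> \<rho> by blast
    next
      fix x and i :: nat
      assume x: "x \<in> ?S" and "1 \<le> i"
      then obtain n where i: "i = Suc n" by (cases i) auto
      have V: "0 \<le> ?V x" using lyapunov_ge_1[OF assms(3), of \<delta> x] by simp
      have prob: "sq_prob M s q D \<xi> i x = pmf (kernel_power ?K n x)"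
        unfolding i using sq_prob_kernel_power[OF dem, of s q n x] by (intro ext)
      show "(\<lambda>y. \<bar>sq_prob M s q D \<xi> i x y - pmf \<pi> y\<bar>) summable_on ?S"
        unfolding prob by (rule l1_infsum_le(1)[OF bound[OF x]])
      have "(\<Sum>\<^sub>\<infinity>y\<in>?S. \<bar>sq_prob M s q D \<xi> i x y - pmf \<pi> y\<bar>) \<le> C * ?V x * \<rho> ^ n"
        unfolding prob by (rule l1_infsum_le(2)[OF bound[OF x]])
      also have "\<dots> = ?V x * (\<beta> * \<rho> ^ i)"
        using \<rho> by (simp add: \<beta>_def i)
      \<comment> \<open>The factor 2 is the quotient of \<rho> by \<rho> - \<theta> = \<rho> /
        2.\<close>
      also have "\<dots> \<le> ?V x * (2 * (1 + \<beta>) * \<rho> ^ i)"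
        using V \<beta> \<rho> by (intro mult_left_mono mult_right_mono) auto
      also have "2 * (1 + \<beta>) * \<rho> ^ i = (1 + \<beta>) * \<rho> ^ (i + 1) / (\<rho> - \<rho> / 2)"
        using \<rho> by (simp add: field_simps)
      finally show "(\<Sum>\<^sub>\<infinity>y\<in>?S. \<bar>sq_prob M s q D \<xi> i x y - pmf \<pi> y\<bar>)
          \<le> ?V x * ((1 + \<beta>) * \<rho> ^ (i + 1) / (\<rho> - \<rho> / 2))" .
    qed
  qed (use \<beta> \<rho> in auto)
qed

end
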